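(* Let $n,p$ be positive integers with $n-p-1>0$, let $M\in\mathbb{R}^{n\times p}$, and let $X\in\mathbb{R}^{n\times p}$ be a random matrix with independent entries $X_{ij}\sim \mathrm{N}(M_{ij},1)$. Let $\hat{M}_{\mathrm{EM}} = X\left(I_p-(n-p-1)(X^{\top}X)^{-1}\right)$ be the Efron--Morris estimator and, for $C\in\mathbb{R}^{p\times p}$, let $\hat{M}_C = XC$. Then for every $M$, $$\mathrm{E}_M\left[(\hat{M}_{\mathrm{EM}}-M)^{\top}(\hat{M}_{\mathrm{EM}}-M)\right] \preceq \mathrm{E}_M\left[(\hat{M}_{C_*}-M)^{\top}(\hat{M}_{C_*}-M)\right] + 2(p+1)I_p,$$ where $C_*=C_*(M)=(M^{\top}M+nI_p)^{-1}M^{\top}M$.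
   Context: $\mathrm{E}_M$ denotes expectation over $X$ when the mean matrix is $M$. For symmetric matrices $A,B\in\mathbb{R}^{p\times p}$, $A\preceq B$ means that $B-A$ is positive semidefinite (L\"owner order). The matrix $\mathrm{E}_M[(\hat{M}-M)^{\top}(\hat{M}-M)]$ is called the matrix quadratic risk of the estimator $\hat{M}$. In $\hat{M}_{C_*}$ the matrix $C_*(M)$ is evaluated at the true (nonrandom) mean matrix $M$. *)

theory Defs
  imports "HOL-Probability.Probability"
begin

(* An n x p matrix is an element of real ^ 'p ^ 'n, with n = CARD('n) rows and p = CARD('p)
   columns, so X $ i $ j is the entry in row i and column j. *)

definition positive_semidefinite :: "real ^ 'k ^ 'k \<Rightarrow> bool" where
  "positive_semidefinite A \<longleftrightarrow> transpose A = A \<and> (\<forall>x. 0 \<le> x \<bullet> (A *v x))"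

definition loewner_le :: "real ^ 'k ^ 'k \<Rightarrow> real ^ 'k ^ 'k \<Rightarrow> bool" (infix "\<preceq>" 50) where
  "A \<preceq> B \<longleftrightarrow> positive_semidefinite (B - A)"

(* The entries of X are independent and X_ij has the N(M_ij, 1) distribution. *)
definition gaussian_matrix ::
  "'a measure \<Rightarrow> ('a \<Rightarrow> real ^ 'p ^ 'n) \<Rightarrow> real ^ 'p ^ 'n \<Rightarrow> bool" where
  "gaussian_matrix P X M \<longleftrightarrow>
     prob_space.indep_vars P (\<lambda>_. borel) (\<lambda>(i, j) \<omega>. X \<omega> $ i $ j) (UNIV :: ('n \<times> 'p) set) \<and>
     (\<forall>i j. distributed P lborel (\<lambda>\<omega>. X \<omega> $ i $ j) (normal_density (M $ i $ j) 1))"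

(* matrix_inv is an unspecified constant on singular matrices; when p <= n, X^T X is singular
   only on a null event. *)
definition efron_morris :: "real ^ 'p ^ 'n \<Rightarrow> real ^ 'p ^ 'n" where
  "efron_morris X =
     X ** (mat 1 - (real CARD('n) - real CARD('p) - 1) *\<^sub>R matrix_inv (transpose X ** X))"

definition linear_estimator :: "real ^ 'p ^ 'p \<Rightarrow> real ^ 'p ^ 'n \<Rightarrow> real ^ 'p ^ 'n" where
  "linear_estimator C X = X ** C"

definition optimal_coeff :: "real ^ 'p ^ 'n \<Rightarrow> real ^ 'p ^ 'p" where
  "optimal_coeff M =
     matrix_inv (transpose M ** M + real CARD('n) *\<^sub>R mat 1) ** (transpose M ** M)"

definition matrix_quadratic_loss ::
  "(real ^ 'p ^ 'n \<Rightarrow> real ^ 'p ^ 'n) \<Rightarrow> real ^ 'p ^ 'n \<Rightarrow> real ^ 'p ^ 'n \<Rightarrow> real ^ 'p ^ 'p" where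
  "matrix_quadratic_loss est M X = transpose (est X - M) ** (est X - M)"

(* The Bochner integral is 0 for a non-integrable loss, so statements about the risk should
   be accompanied by integrability of the loss. *)
definition matrix_quadratic_risk ::
  "'a measure \<Rightarrow> ('a \<Rightarrow> real ^ 'p ^ 'n) \<Rightarrow> (real ^ 'p ^ 'n \<Rightarrow> real ^ 'p ^ 'n) \<Rightarrow> real ^ 'p ^ 'n
     \<Rightarrow> real ^ 'p ^ 'p" where
  "matrix_quadratic_risk P X est M = (\<integral>\<omega>. matrix_quadratic_loss est M (X \<omega>) \<partial>P)"

end

theory Submission
  imports Defs "HOL-Real_Asymp.Real_Asymp"
begin

text \<open>
  Write \<open>c = n - p - 1\<close> and \<open>S = X\<^sup>T X\<close>.  A Loewner inequality is an inequality between quadratic forms,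
  so fix a vector \<open>v\<close>; the form of a risk matrix at \<open>v\<close> is the mean of \<open>\<bar>(est X - M) v\<bar>\<^sup>2\<close>.

  For the Efron--Morris estimator, expanding the square gives
  \<open>\<bar>(X - M) v\<bar>\<^sup>2 - 2 c \<langle>(X - M) v, X S\<^sup>-\<^sup>1 v\<rangle> + c\<^sup>2 \<langle>v, S\<^sup>-\<^sup>1 v\<rangle>\<close>.  Stein's identity turns the mean of the
  cross term into the mean of a divergence, which equals \<open>c \<langle>v, S\<^sup>-\<^sup>1 v\<rangle>\<close>, so the risk is at most
  \<open>n \<bar>v\<bar>\<^sup>2 - c\<^sup>2 E \<langle>v, S\<^sup>-\<^sup>1 v\<rangle>\<close> (lemma \<open>efron_morris_loss_mean\<close>).  For the linear estimator a direct second
  moment computation gives exactly \<open>n \<bar>v\<bar>\<^sup>2 - n\<^sup>2 \<langle>v, r\<rangle>\<close> with \<open>r = (M\<^sup>T M + n I)\<^sup>-\<^sup>1 v\<close> (lemma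
  \<open>optimal_linear_loss_mean\<close>).  Since \<open>M\<^sup>T M + n I\<close> is the mean of \<open>S\<close>, convexity of matrix inversion gives
  \<open>E \<langle>v, S\<^sup>-\<^sup>1 v\<rangle> \<ge> \<langle>v, r\<rangle>\<close> (lemma \<open>inverse_gram_mean_lower_bound\<close>).  What remains is
  \<open>(n\<^sup>2 - c\<^sup>2) \<langle>v, r\<rangle> \<le> 2 n (p + 1) \<langle>v, r\<rangle> \<le> 2 (p + 1) \<bar>v\<bar>\<^sup>2\<close>.

  The analytic difficulty is that \<open>S\<^sup>-\<^sup>1\<close> is unbounded and \<open>S\<close> may be singular.  Everything is therefore first
  done with \<open>S + e I\<close>, \<open>e > 0\<close>, in place of \<open>S\<close>, where the functions entering
  Stein's identity are bounded and smooth.  There the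
  divergence is still at least \<open>c \<langle>v, (S + e I)\<^sup>-\<^sup>1 v\<rangle>\<close> (lemma \<open>divergence_lower_bound\<close>), and Cauchy--Schwarz
  applied to the other side of Stein's identity bounds the mean of this quadratic form by \<open>n \<bar>v\<bar>\<^sup>2 / c\<^sup>2\<close>,
  uniformly in \<open>e\<close> (lemma \<open>ridge_quadform_mean_le\<close>).  Letting \<open>e\<close> tend to \<open>0\<close>, monotone convergence yields at
  once that \<open>S\<close> is almost surely invertible and that \<open>\<langle>v, S\<^sup>-\<^sup>1 v\<rangle>\<close> is integrable, and the latter dominates the
  cross terms.
\<close>

section \<open>Ridge-regularised Gram matrices\<close>

definition ridge_gram :: "real \<Rightarrow> real ^ 'p ^ 'n \<Rightarrow> real ^ 'p ^ 'p" where
  "ridge_gram e Y = transpose Y ** Y + e *\<^sub>R mat 1"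

text \<open>For \<open>e = 0\<close> this is \<open>(Y\<^sup>T Y)\<^sup>-\<^sup>1 v\<close>, so the unregularised case is the same formula.\<close>

definition ridge_solve :: "real \<Rightarrow> real ^ 'p ^ 'n \<Rightarrow> real ^ 'p \<Rightarrow> real ^ 'p" where
  "ridge_solve e Y v = matrix_inv (ridge_gram e Y) *v v"

lemma ridge_gram_0: "ridge_gram 0 Y = transpose Y ** Y"
  by (simp add: ridge_gram_def)

lemma inner_transpose_mult: "x \<bullet> (transpose A *v y) = (A *v x) \<bullet> (y::real^'n)"
  for A :: "real^'p^'n"
  by (metis dot_lmul_matrix inner_commute vector_transpose_matrix transpose_transpose)

lemma ridge_gram_mult:
  "ridge_gram e Y *v w = transpose Y *v (Y *v w) + e *\<^sub>R w"
  by (simp add: ridge_gram_def matrix_vector_mult_add_rdistrib matrix_vector_mul_assoc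
      scaleR_matrix_vector_assoc[symmetric])

lemma inner_ridge_gram:
  "u \<bullet> (ridge_gram e Y *v w) = (Y *v u) \<bullet> (Y *v w) + e * (u \<bullet> w)"
  by (simp add: ridge_gram_mult inner_add_right inner_transpose_mult del: vector_transpose_matrix transpose_matrix_vector)

lemma matrix_inv_solves:
  fixes A :: "real^'p^'p"
  assumes "invertible A"
  shows "A *v (matrix_inv A *v v) = v" "matrix_inv A *v (A *v v) = v"
proof -
  have "A ** matrix_inv A = mat 1 \<and> matrix_inv A ** A = mat 1"
    unfolding matrix_inv_def by (rule someI_ex) (use assms in \<open>auto simp: invertible_def\<close>)
  then show "A *v (matrix_inv A *v v) = v" "matrix_inv A *v (A *v v) = v"
    by (simp_all add: matrix_vector_mul_assoc)
qed

lemma invertible_if_kernel_trivial: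
  fixes A :: "real^'p^'p"
  assumes "\<And>z. A *v z = 0 \<Longrightarrow> z = 0"
  shows "invertible A"
  using assms matrix_left_invertible_ker[of A] invertible_left_inverse[of A] by blast

lemma invertible_ridge_gram:
  assumes "e > 0" shows "invertible (ridge_gram e Y)"
proof (rule invertible_if_kernel_trivial)
  fix z assume "ridge_gram e Y *v z = 0"
  then have "(norm (Y *v z))\<^sup>2 + e * (norm z)\<^sup>2 = 0"
    using inner_ridge_gram[of z e Y z] by (simp add: power2_norm_eq_inner)
  with assms have "(norm z)\<^sup>2 = 0"
    by (metis add_nonneg_eq_0_iff less_eq_real_def mult_eq_0_iff not_less_iff_gr_or_eq mult_nonneg_nonneg zero_le_power2)
  then show "z = 0" by simp
qed

lemma ridge_solve_solves:
  assumes "invertible (ridge_gram e Y)"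
  shows "ridge_gram e Y *v ridge_solve e Y v = v"
  using matrix_inv_solves[OF assms] by (simp add: ridge_solve_def)

lemma ridge_solve_symmetric:
  assumes "invertible (ridge_gram e Y)"
  shows "u \<bullet> ridge_solve e Y v = v \<bullet> ridge_solve e Y u"
proof -
  have "v \<bullet> ridge_solve e Y u = (Y *v ridge_solve e Y u) \<bullet> (Y *v ridge_solve e Y v)
      + e * (ridge_solve e Y u \<bullet> ridge_solve e Y v)"
    using inner_ridge_gram[of "ridge_solve e Y u" e Y "ridge_solve e Y v"] assms
    by (simp add: ridge_solve_solves inner_commute)
  moreover have "u \<bullet> ridge_solve e Y v = (Y *v ridge_solve e Y v) \<bullet> (Y *v ridge_solve e Y u)
      + e * (ridge_solve e Y v \<bullet> ridge_solve e Y u)"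
    using inner_ridge_gram[of "ridge_solve e Y v" e Y "ridge_solve e Y u"] assms
    by (simp add: ridge_solve_solves inner_commute)
  ultimately show ?thesis by (simp add: inner_commute)
qed

lemma row_inner_ridge_solve_axis:
  assumes "invertible (ridge_gram e Y)"
  shows "Y $ i \<bullet> ridge_solve e Y (axis j 1) = ridge_solve e Y (Y $ i) $ j"
  by (simp add: ridge_solve_symmetric[OF assms, of "Y $ i"] inner_axis')

lemma ridge_energy:
  assumes "invertible (ridge_gram e Y)"
  shows "v \<bullet> ridge_solve e Y v
    = (norm (Y *v ridge_solve e Y v))\<^sup>2 + e * (norm (ridge_solve e Y v))\<^sup>2"
  using inner_ridge_gram[of "ridge_solve e Y v" e Y "ridge_solve e Y v"] assms
  by (simp add: ridge_solve_solves inner_commute power2_norm_eq_inner)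

text \<open>The form of the inverse is the maximum over \<open>w\<close> of the left-hand side, attained at \<open>w = (Y\<^sup>T Y + e I)\<^sup>-\<^sup>1 v\<close>; the
defect is the energy of the difference.  This one bound gives the monotonicity in \<open>e\<close>, the detection of
singular Gram matrices, and the Jensen-type inequality for the mean of the inverse Gram matrix: for fixed \<open>w\<close>,
the left-hand side is affine in the Gram matrix.\<close>

lemma ridge_variational:
  assumes inv: "invertible (ridge_gram e Y)" and "e \<ge> 0"
  shows "2 * (v \<bullet> w) - (norm (Y *v w))\<^sup>2 - e * (norm w)\<^sup>2 \<le> v \<bullet> ridge_solve e Y v"
proof -
  let ?u = "ridge_solve e Y v"
  have uw: "(Y *v w) \<bullet> (Y *v ?u) + e * (w \<bullet> ?u) = v \<bullet> w"
    using inner_ridge_gram[of w e Y ?u] inv by (simp add: ridge_solve_solves inner_commute)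
  have "0 \<le> (norm (Y *v ?u - Y *v w))\<^sup>2 + e * (norm (?u - w))\<^sup>2"
    using assms by simp
  also have "\<dots> = ((norm (Y *v ?u))\<^sup>2 + e * (norm ?u)\<^sup>2) + (norm (Y *v w))\<^sup>2 + e * (norm w)\<^sup>2
     - 2 * ((Y *v w) \<bullet> (Y *v ?u) + e * (w \<bullet> ?u))"
    by (simp add: power2_norm_eq_inner inner_diff_left inner_diff_right inner_commute algebra_simps)
  finally show ?thesis unfolding uw ridge_energy[OF inv, symmetric] by simp
qed

lemma ridge_quadform_antimono:
  assumes inv: "invertible (ridge_gram d Y)" and "0 \<le> d" "d \<le> e" "e > 0"
  shows "v \<bullet> ridge_solve e Y v \<le> v \<bullet> ridge_solve d Y v"
proof -
  let ?w = "ridge_solve e Y v"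
  have "d * (norm ?w)\<^sup>2 \<le> e * (norm ?w)\<^sup>2" using assms by (simp add: mult_right_mono)
  then show ?thesis
    using ridge_variational[OF inv \<open>0 \<le> d\<close>, of v ?w] ridge_energy[of e Y v]
      invertible_ridge_gram[OF \<open>e > 0\<close>, of Y] by linarith
qed

lemma ridge_quadform_nonneg:
  assumes inv: "invertible (ridge_gram e Y)" and "0 \<le> e"
  shows "0 \<le> v \<bullet> ridge_solve e Y v"
  using ridge_energy[OF inv, of v] assms by simp

lemma ridge_fit_le_quadform:
  assumes inv: "invertible (ridge_gram e Y)" and "0 \<le> e"
  shows "(norm (Y *v ridge_solve e Y v))\<^sup>2 \<le> v \<bullet> ridge_solve e Y v"
  using ridge_energy[OF inv, of v] assms by simp

lemma norm_ridge_solve_le: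
  assumes "e > 0"
  shows "norm (ridge_solve e Y v) \<le> norm v / e"
proof -
  let ?w = "ridge_solve e Y v"
  have "e * (norm ?w)\<^sup>2 \<le> v \<bullet> ?w"
    using ridge_energy[OF invertible_ridge_gram[OF assms, of Y], of v] by simp
  also have "\<dots> \<le> norm v * norm ?w" by (rule norm_cauchy_schwarz)
  finally have "(e * norm ?w) * norm ?w \<le> norm v * norm ?w" by (simp add: power2_eq_square)
  then have "e * norm ?w \<le> norm v"
    by (cases "norm ?w = 0") auto
  then show ?thesis using assms by (simp add: field_simps)
qed

lemma ridge_quadform_le:
  assumes "e > 0"
  shows "v \<bullet> ridge_solve e Y v \<le> (norm v)\<^sup>2 / e"
proof -
  have "v \<bullet> ridge_solve e Y v \<le> norm v * norm (ridge_solve e Y v)" by (rule norm_cauchy_schwarz)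
  also have "\<dots> \<le> norm v * (norm v / e)"
    by (intro mult_left_mono norm_ridge_solve_le assms) auto
  finally show ?thesis by (simp add: power2_eq_square)
qed

lemma row_ridge_solve_le:
  assumes "e > 0"
  shows "\<bar>Y $ i \<bullet> ridge_solve e Y v\<bar> \<le> norm v / sqrt e"
proof -
  have "\<bar>Y $ i \<bullet> ridge_solve e Y v\<bar> \<le> norm (Y *v ridge_solve e Y v)"
    using component_le_norm_cart[of "Y *v ridge_solve e Y v" i]
    by (simp add: matrix_vector_mul_component)
  also have "\<dots> \<le> sqrt ((norm v)\<^sup>2 / e)"
    using ridge_fit_le_quadform[OF invertible_ridge_gram[OF assms, of Y], of v] assms
      ridge_quadform_le[OF assms, of v Y] by (intro real_le_rsqrt) auto
  also have "\<dots> = norm v / sqrt e" by (simp add: real_sqrt_divide)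
  finally show ?thesis .
qed

text \<open>The leverage \<open>h\<close> of a row is a coordinate of a fitted vector of squared norm at most \<open>h\<close>, so \<open>h\<^sup>2 \<le> h\<close>.\<close>

lemma leverage_bounds:
  assumes "e > 0"
  shows "0 \<le> Y $ i \<bullet> ridge_solve e Y (Y $ i)" "Y $ i \<bullet> ridge_solve e Y (Y $ i) \<le> 1"
proof -
  let ?h = "Y $ i \<bullet> ridge_solve e Y (Y $ i)"
  have inv: "invertible (ridge_gram e Y)" by (rule invertible_ridge_gram[OF assms])
  show h0: "0 \<le> ?h" by (rule ridge_quadform_nonneg[OF inv]) (use assms in simp)
  have "\<bar>?h\<bar> \<le> norm (Y *v ridge_solve e Y (Y$i))"
    using component_le_norm_cart[of "Y *v ridge_solve e Y (Y$i)" i]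
    by (simp add: matrix_vector_mul_component)
  then have "?h\<^sup>2 \<le> (norm (Y *v ridge_solve e Y (Y$i)))\<^sup>2" using h0 by (intro power_mono) auto
  also have "\<dots> \<le> ?h" by (rule ridge_fit_le_quadform[OF inv]) (use assms in simp)
  finally show "?h \<le> 1" using h0 by (cases "?h = 0") (auto simp: power2_eq_square)
qed

text \<open>The sum is the trace of \<open>(Y\<^sup>T Y + e I)\<^sup>-\<^sup>1 Y\<^sup>T Y = I - e (Y\<^sup>T Y + e I)\<^sup>-\<^sup>1\<close>, written out as a sum over the columns of
\<open>Y\<close>.\<close>

lemma sum_leverage_le:
  fixes Y :: "real ^ 'p ^ 'n"
  assumes "e > 0"
  shows "(\<Sum>i\<in>UNIV. Y $ i \<bullet> ridge_solve e Y (Y $ i)) \<le> real CARD('p)"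
proof -
  have inv: "invertible (ridge_gram e Y)" by (rule invertible_ridge_gram[OF assms])
  let ?w = "\<lambda>j. ridge_solve e Y (axis j 1)"
  have entry: "ridge_solve e Y (Y $ i) $ j = (Y *v ?w j) $ i" for i j
    by (simp add: row_inner_ridge_solve_axis[OF inv, symmetric] matrix_vector_mul_component)
  have col: "Y $ i $ j = (Y *v axis j 1) $ i" for i j
    by (simp add: matrix_vector_mul_component inner_axis)
  have "(\<Sum>i\<in>UNIV. Y $ i \<bullet> ridge_solve e Y (Y $ i)) = (\<Sum>i\<in>UNIV. \<Sum>j\<in>UNIV. Y $ i $ j * (Y *v ?w j) $ i)"
    by (simp add: inner_vec_def entry)
  also have "\<dots> = (\<Sum>j\<in>UNIV. (Y *v axis j 1) \<bullet> (Y *v ?w j))"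
    unfolding col by (subst sum.swap) (simp add: inner_vec_def)
  also have "\<dots> \<le> (\<Sum>j\<in>(UNIV::'p set). 1)"
  proof (rule sum_mono)
    fix j
    have "(Y *v axis j 1) \<bullet> (Y *v ?w j) + e * (axis j 1 \<bullet> ?w j) = 1"
      using inner_ridge_gram[of "axis j 1" e Y "?w j"] by (simp add: ridge_solve_solves[OF inv] inner_axis)
    moreover have "0 \<le> e * (axis j 1 \<bullet> ?w j)"
      using ridge_quadform_nonneg[OF inv] assms by simp
    ultimately show "(Y *v axis j 1) \<bullet> (Y *v ?w j) \<le> 1" by linarith
  qed
  finally show ?thesis by simp
qed

section \<open>Continuity and measurability of matrix inversion\<close>

lemma matrix_inv_mult_cramer:
  fixes A :: "real^'p^'p"
  assumes "det A \<noteq> 0"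
  shows "matrix_inv A *v b = (\<chi> k. det (\<chi> i j. if j = k then b $ i else A $ i $ j) / det A)"
  using cramer[OF assms, of "matrix_inv A *v b" b] matrix_inv_solves(1)[of A b] assms
  by (simp add: invertible_det_nz)

lemma tendsto_det:
  fixes f :: "'a \<Rightarrow> real^'p^'p"
  assumes "(f \<longlongrightarrow> A) F"
  shows "((\<lambda>x. det (f x)) \<longlongrightarrow> det A) F"
  unfolding det_def by (intro tendsto_intros assms)

lemma tendsto_matrix_inv_mult:
  fixes f :: "'a \<Rightarrow> real^'p^'p"
  assumes f: "(f \<longlongrightarrow> A) F" and A: "invertible A"
  shows "((\<lambda>x. matrix_inv (f x) *v b) \<longlongrightarrow> matrix_inv A *v b) F"
proof -
  have d: "det A \<noteq> 0" using A by (simp add: invertible_det_nz)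
  have "((\<lambda>x. \<chi> k. det (\<chi> i j. if j = k then b $ i else f x $ i $ j) / det (f x)) \<longlongrightarrow>
     (\<chi> k. det (\<chi> i j. if j = k then b $ i else A $ i $ j) / det A)) F"
  proof (intro tendsto_vec_lambda tendsto_divide tendsto_det f d)
    fix i j k show "((\<lambda>x. if j = k then b $ i else f x $ i $ j) \<longlongrightarrow> (if j = k then b $ i else A $ i $ j)) F"
      by (cases "j = k") (auto intro!: tendsto_intros f)
  qed
  moreover have "\<forall>\<^sub>F x in F. det (f x) \<noteq> 0"
    using tendsto_imp_eventually_ne[OF tendsto_det[OF f] d] .
  ultimately show ?thesis
    unfolding matrix_inv_mult_cramer[OF d]
    by (elim Lim_transform_eventually) (auto elim!: eventually_mono simp: matrix_inv_mult_cramer)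
qed

text \<open>On singular matrices no inverse exists, so there the choice operator returns one and the same matrix.\<close>

lemma borel_measurable_matrix_inv_mult:
  "(\<lambda>A::real^'p^'p. matrix_inv A *v b) \<in> borel_measurable borel"
proof -
  have singular: "matrix_inv A = (SOME A'::real^'p^'p. False)" if "det A = 0" for A :: "real^'p^'p"
  proof -
    have none: "\<And>A'::real^'p^'p. (A ** A' = mat 1 \<and> A' ** A = mat 1) = False"
      using that invertible_det_nz[of A] by (auto simp: invertible_def)
    show ?thesis unfolding matrix_inv_def by (intro arg_cong[where f=Eps] ext none)
  qed
  have d: "det \<in> borel_measurable (borel :: (real^'p^'p) measure)"
    by (intro borel_measurable_continuous_onI continuous_at_imp_continuous_on)
       (auto simp: isCont_def intro!: tendsto_det tendsto_ident_at)
  have "(\<lambda>A. det (\<chi> i j. if j = k then b $ i else A $ i $ j)) \<in> borel_measurable (borel :: (real^'p^'p) measure)" for k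
  proof (intro borel_measurable_continuous_onI continuous_at_imp_continuous_on ballI, unfold isCont_def, intro tendsto_det tendsto_vec_lambda)
    fix A :: "real^'p^'p" and i j
    show "(\<lambda>A. if j = k then b $ i else A $ i $ j) \<midarrow>A\<rightarrow> (if j = k then b $ i else A $ i $ j)"
      by (cases "j = k") (auto intro!: tendsto_intros)
  qed
  then have c: "(\<lambda>A. \<chi> k. det (\<chi> i j. if j = k then b $ i else A $ i $ j) / det A) 
     \<in> borel_measurable (borel :: (real^'p^'p) measure)"
    using d by (subst borel_measurable_euclidean_space) (auto simp: Basis_vec_def inner_axis)
  have "(\<lambda>A. if det A = 0 then (SOME A'::real^'p^'p. False) *v b
      else (\<chi> k. det (\<chi> i j. if j = k then b $ i else A $ i $ j) / det A)) \<in> borel_measurable (borel :: (real^'p^'p) measure)"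
    by (intro measurable_If c) (use d in \<open>auto simp: pred_def\<close>)
  also have "(\<lambda>A. if det A = 0 then (SOME A'::real^'p^'p. False) *v b
      else (\<chi> k. det (\<chi> i j. if j = k then b $ i else A $ i $ j) / det A)) = (\<lambda>A. matrix_inv A *v b)"
    by (auto simp: singular matrix_inv_mult_cramer)
  finally show ?thesis .
qed

lemma tendsto_ridge_gram:
  fixes f :: "'a \<Rightarrow> real ^ 'p ^ 'n"
  assumes "(a \<longlongrightarrow> e) F" "(f \<longlongrightarrow> Y) F"
  shows "((\<lambda>x. ridge_gram (a x) (f x)) \<longlongrightarrow> ridge_gram e Y) F"
  unfolding ridge_gram_def matrix_matrix_mult_def transpose_def
  by (auto intro!: tendsto_intros assms)

lemma tendsto_ridge_solve:
  assumes "(a \<longlongrightarrow> e) F" "(f \<longlongrightarrow> Y) F" "invertible (ridge_gram e Y)"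
  shows "((\<lambda>x. ridge_solve (a x) (f x) v) \<longlongrightarrow> ridge_solve e Y v) F"
  unfolding ridge_solve_def using assms by (intro tendsto_matrix_inv_mult tendsto_ridge_gram)

lemma continuous_on_ridge_solve:
  assumes "e > 0"
  shows "continuous_on UNIV (\<lambda>Y::real^'p^'n. ridge_solve e Y v)"
  by (intro continuous_at_imp_continuous_on ballI)
     (auto simp: isCont_def intro!: tendsto_ridge_solve invertible_ridge_gram assms tendsto_intros)

lemma borel_measurable_ridge_solve [measurable]:
  "(\<lambda>Y::real^'p^'n. ridge_solve e Y v) \<in> borel_measurable borel"
proof -
  have "continuous_on UNIV (\<lambda>Y::real^'p^'n. ridge_gram e Y)"
    by (intro continuous_at_imp_continuous_on ballI)
       (auto simp: isCont_def intro!: tendsto_ridge_gram tendsto_intros)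
  then have "(\<lambda>Y::real^'p^'n. ridge_gram e Y) \<in> borel_measurable borel"
    by (rule borel_measurable_continuous_onI)
  then show ?thesis unfolding ridge_solve_def
    by (rule measurable_compose[OF _ borel_measurable_matrix_inv_mult])
qed

section \<open>Gaussian integration by parts\<close>

lemma has_real_derivative_normal_density:
  "(normal_density m 1 has_real_derivative (- (x - m) * normal_density m 1 x)) (at x)"
proof -
  have eq: "normal_density m 1 = (\<lambda>x. 1 / sqrt (2 * pi) * exp (- (x - m)\<^sup>2 / 2))"
    by (simp add: normal_density_def fun_eq_iff)
  have "((\<lambda>x. exp (- (x - m)\<^sup>2 / 2)) has_real_derivative - (x - m) * exp (- (x - m)\<^sup>2 / 2)) (at x)"
    by (auto intro!: derivative_eq_intros simp: field_simps)
  from DERIV_cmult[OF this, of "1 / sqrt (2 * pi)"] show ?thesis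
    unfolding eq by (simp add: mult_ac)
qed

lemma normal_density_tendsto_0:
  "(normal_density m 1 \<longlongrightarrow> 0) at_top" "(normal_density m 1 \<longlongrightarrow> 0) at_bot"
  unfolding normal_density_def by real_asymp+

text \<open>The integrand is the derivative of \<open>- f\<close> times the density, which vanishes at both ends of the line.\<close>

lemma integral_normal_stein:
  fixes f f' :: "real \<Rightarrow> real"
  assumes D: "\<And>x. (f has_real_derivative f' x) (at x)"
    and cont: "continuous_on UNIV f'"
    and f: "\<And>x. \<bar>f x\<bar> \<le> C" and f': "\<And>x. \<bar>f' x\<bar> \<le> C"
  shows "(\<integral>x. normal_density m 1 x * ((x - m) * f x - f' x) \<partial>lborel) = 0"
proof -
  let ?d = "normal_density m 1"
  let ?h = "\<lambda>x. ?d x * ((x - m) * f x - f' x)"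
  have cf: "continuous_on UNIV f"
    using D by (intro continuous_at_imp_continuous_on) (auto intro: DERIV_isCont)
  have cd: "continuous_on UNIV ?d"
    using has_real_derivative_normal_density
    by (intro continuous_at_imp_continuous_on) (auto intro: DERIV_isCont)
  have ch: "continuous_on UNIV ?h" by (intro continuous_intros cf cd cont)
  have int: "integrable lborel ?h"
  proof (rule Bochner_Integration.integrable_bound)
    show "integrable lborel (\<lambda>x. C * (?d x * \<bar>x - m\<bar> ^ 1) + C * ?d x)"
      by (intro Bochner_Integration.integrable_add integrable_mult_right integrable_normal_moment_abs
            integrable_normal_density) auto
    show "?h \<in> borel_measurable lborel"
      using borel_measurable_continuous_onI[OF ch] by simp
    have "\<bar>?h x\<bar> \<le> C * (?d x * \<bar>x - m\<bar> ^ 1) + C * ?d x" for x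
    proof -
      have "\<bar>(x - m) * f x - f' x\<bar> \<le> \<bar>x - m\<bar> * C + C"
        using mult_left_mono[OF f[of x], of "\<bar>x - m\<bar>"] f'[of x] abs_triangle_ineq4[of "(x-m) * f x" "f' x"]
        by (simp add: abs_mult)
      then have "?d x * \<bar>(x - m) * f x - f' x\<bar> \<le> ?d x * (\<bar>x - m\<bar> * C + C)"
        by (intro mult_left_mono) auto
      moreover have "\<bar>?h x\<bar> = ?d x * \<bar>(x - m) * f x - f' x\<bar>" by (simp add: abs_mult)
      ultimately show ?thesis by (simp only: power_one_right) (simp add: algebra_simps)
    qed
    then show "AE x in lborel. norm (?h x) \<le> norm (C * (?d x * \<bar>x - m\<bar> ^ 1) + C * ?d x)"
      by (intro AE_I2) (smt (verit) real_norm_def)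
  qed
  have lim: "((\<lambda>x. - (f x * ?d x)) \<longlongrightarrow> 0) F" if "(?d \<longlongrightarrow> 0) F" for F
  proof (rule Lim_null_comparison)
    show "\<forall>\<^sub>F x in F. norm (- (f x * ?d x)) \<le> C * ?d x"
      using f by (intro always_eventually allI) (auto simp: abs_mult intro!: mult_right_mono)
    show "((\<lambda>x. C * ?d x) \<longlongrightarrow> 0) F" using tendsto_mult_left[OF that, of C] by simp
  qed
  have "(LBINT x=-\<infinity>..\<infinity>. ?h x) = 0 - 0"
  proof (rule interval_integral_FTC_integrable)
    show "((\<lambda>x. - (f x * ?d x)) has_vector_derivative ?h x) (at x)" for x
      unfolding has_real_derivative_iff_has_vector_derivative[symmetric]
      by (auto intro!: derivative_eq_intros D has_real_derivative_normal_density simp: algebra_simps)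
    show "isCont ?h x" for x using ch by (simp add: continuous_on_eq_continuous_at)
    show "set_integrable lborel (einterval (-\<infinity>) \<infinity>) ?h" using int by (simp add: set_integrable_def)
    show "(((\<lambda>x. - (f x * ?d x)) \<circ> real_of_ereal) \<longlongrightarrow> 0) (at_right (-\<infinity>))"
      unfolding ereal_tendsto_simps by (rule lim[OF normal_density_tendsto_0(2)])
    show "(((\<lambda>x. - (f x * ?d x)) \<circ> real_of_ereal) \<longlongrightarrow> 0) (at_left \<infinity>)"
      unfolding ereal_tendsto_simps by (rule lim[OF normal_density_tendsto_0(1)])
  qed simp
  then show ?thesis
    by (simp add: interval_lebesgue_integral_def set_lebesgue_integral_def)
qed

lemma gaussian_matrixD:
  assumes "gaussian_matrix P X M"
  shows "prob_space.indep_vars P (\<lambda>_. borel) (\<lambda>(i, j) \<omega>. X \<omega> $ i $ j) UNIV"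
    and "distributed P lborel (\<lambda>\<omega>. X \<omega> $ i $ j) (normal_density (M $ i $ j) 1)"
  using assms by (auto simp: gaussian_matrix_def)

lemma gaussian_matrix_measurable:
  assumes "gaussian_matrix P X M"
  shows "X \<in> borel_measurable P"
proof -
  have "(\<lambda>\<omega>. X \<omega> $ i $ j) \<in> borel_measurable P" for i j
    using distributed_measurable[OF gaussian_matrixD(2)[OF assms, of i j]] by simp
  then show ?thesis
    by (subst borel_measurable_euclidean_space) (auto simp: Basis_vec_def inner_axis)
qed

text \<open>The entry is carried along as a multiple of the unit matrix at \<open>(i, j)\<close> because independence of a pair of
random variables is stated for variables of a common type.\<close>

lemma gaussian_matrix_entry_indep_rest:
  fixes X :: "'a \<Rightarrow> real ^ 'p ^ 'n"
  assumes P: "prob_space P" and G: "gaussian_matrix P X M"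
  shows "prob_space.indep_var P borel (\<lambda>\<omega>. (X \<omega> $ i $ j) *\<^sub>R axis i (axis j 1))
           borel (\<lambda>\<omega>. X \<omega> - (X \<omega> $ i $ j) *\<^sub>R axis i (axis j 1))"
proof -
  interpret prob_space P by fact
  let ?Z = "\<lambda>(i, j) \<omega>. X \<omega> $ i $ j"
  let ?pick = "\<lambda>r. r (i, j) *\<^sub>R axis i (axis j 1) :: real ^ 'p ^ 'n"
  let ?fill = "\<lambda>r. (\<chi> k l. if (k, l) = (i, j) then 0 else r (k, l)) :: real ^ 'p ^ 'n"
  have pick: "?pick \<in> borel_measurable (PiM {(i, j)} (\<lambda>_. borel))"
    by measurable
  have fill: "?fill \<in> borel_measurable (PiM (- {(i, j)}) (\<lambda>_. borel))"
  proof (subst borel_measurable_euclidean_space, intro ballI)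
    fix b :: "real^'p^'n" assume "b \<in> Basis"
    then obtain k l where b: "b = axis k (axis l 1)" by (auto simp: Basis_vec_def)
    have "(\<lambda>r::'n \<times> 'p \<Rightarrow> real. if (k, l) = (i, j) then 0 else r (k, l))
        \<in> borel_measurable (PiM (- {(i, j)}) (\<lambda>_. borel))"
      by (cases "(k, l) = (i, j)") (auto intro!: measurable_component_singleton)
    then show "(\<lambda>r. ?fill r \<bullet> b) \<in> borel_measurable (PiM (- {(i, j)}) (\<lambda>_. borel))"
      by (simp add: b inner_axis)
  qed
  have "indep_var borel (?pick \<circ> (\<lambda>\<omega>. restrict (\<lambda>q. ?Z q \<omega>) {(i, j)}))
      borel (?fill \<circ> (\<lambda>\<omega>. restrict (\<lambda>q. ?Z q \<omega>) (- {(i, j)})))"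
    by (rule indep_var_compose[OF indep_var_restrict[OF gaussian_matrixD(1)[OF G]] pick fill]) auto
  also have "?pick \<circ> (\<lambda>\<omega>. restrict (\<lambda>q. ?Z q \<omega>) {(i, j)}) = (\<lambda>\<omega>. (X \<omega> $ i $ j) *\<^sub>R axis i (axis j 1))"
    by (auto simp: fun_eq_iff)
  also have "?fill \<circ> (\<lambda>\<omega>. restrict (\<lambda>q. ?Z q \<omega>) (- {(i, j)}))
      = (\<lambda>\<omega>. X \<omega> - (X \<omega> $ i $ j) *\<^sub>R axis i (axis j 1))"
    by (auto simp: fun_eq_iff vec_eq_iff axis_def)
  finally show ?thesis .
qed

lemma gaussian_matrix_entry_integral:
  assumes G: "gaussian_matrix P X M"
    and [measurable]: "h \<in> borel_measurable borel"
  shows "(\<integral>\<omega>. h (X \<omega> $ i $ j) \<partial>P) = (\<integral>x. normal_density (M $ i $ j) 1 x * h x \<partial>lborel)"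
  by (rule distributed_integral[OF gaussian_matrixD(2)[OF G], symmetric]) auto

lemma gaussian_matrix_entry_moment_integrable:
  assumes G: "gaussian_matrix P X M"
  shows "integrable P (\<lambda>\<omega>. \<bar>X \<omega> $ i $ j - M $ i $ j\<bar> ^ k)"
  using distributed_integrable[OF gaussian_matrixD(2)[OF G, of i j], of "\<lambda>x. \<bar>x - M $ i $ j\<bar> ^ k"]
    integrable_normal_moment_abs[of 1 "M $ i $ j" k]
  by auto

text \<open>Splitting \<open>X\<close> into its entry at \<open>(i, j)\<close> and the independent rest, Fubini's theorem reduces the identity to the
one-dimensional one.\<close>

lemma gaussian_matrix_stein:
  fixes X :: "'a \<Rightarrow> real ^ 'p ^ 'n" and f g :: "real ^ 'p ^ 'n \<Rightarrow> real"
  assumes P: "prob_space P" and G: "gaussian_matrix P X M"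
    and D: "\<And>Y. ((\<lambda>s. f (Y + s *\<^sub>R axis i (axis j 1))) has_real_derivative g Y) (at 0)"
    and cf: "continuous_on UNIV f" and cg: "continuous_on UNIV g"
    and f: "\<And>Y. \<bar>f Y\<bar> \<le> C" and g: "\<And>Y. \<bar>g Y\<bar> \<le> C"
  shows "integrable P (\<lambda>\<omega>. (X \<omega> $ i $ j - M $ i $ j) * f (X \<omega>))" "integrable P (\<lambda>\<omega>. g (X \<omega>))"
    and "(\<integral>\<omega>. (X \<omega> $ i $ j - M $ i $ j) * f (X \<omega>) \<partial>P) = (\<integral>\<omega>. g (X \<omega>) \<partial>P)"
proof -
  interpret prob_space P by fact
  let ?E = "axis i (axis j 1) :: real ^ 'p ^ 'n"
  let ?m = "M $ i $ j"
  let ?x = "\<lambda>\<omega>. X \<omega> $ i $ j"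
  let ?xE = "\<lambda>\<omega>. ?x \<omega> *\<^sub>R ?E"
  let ?R = "\<lambda>\<omega>. X \<omega> - ?x \<omega> *\<^sub>R ?E"
  let ?h = "\<lambda>Y r. (Y $ i $ j - ?m) * f (r + Y) - g (r + Y)"
  have [measurable]: "(\<lambda>Y::real^'p^'n. Y $ i $ j) \<in> borel_measurable borel"
    by (intro borel_measurable_continuous_onI continuous_intros)
  note [measurable] = gaussian_matrix_measurable[OF G]
    borel_measurable_continuous_onI[OF cf] borel_measurable_continuous_onI[OF cg]
  have x [measurable]: "?x \<in> borel_measurable P"
    using distributed_measurable[OF gaussian_matrixD(2)[OF G, of i j]] by simp
  show int_f: "integrable P (\<lambda>\<omega>. (?x \<omega> - ?m) * f (X \<omega>))"
  proof (rule Bochner_Integration.integrable_bound)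
    show "integrable P (\<lambda>\<omega>. C * \<bar>?x \<omega> - ?m\<bar> ^ 1)"
      by (intro integrable_mult_right gaussian_matrix_entry_moment_integrable[OF G])
    show "AE \<omega> in P. norm ((?x \<omega> - ?m) * f (X \<omega>)) \<le> norm (C * \<bar>?x \<omega> - ?m\<bar> ^ 1)"
    proof (intro AE_I2)
      fix \<omega>
      have "\<bar>?x \<omega> - ?m\<bar> * \<bar>f (X \<omega>)\<bar> \<le> \<bar>?x \<omega> - ?m\<bar> * \<bar>C\<bar>"
        using f[of "X \<omega>"] by (intro mult_left_mono) auto
      then show "norm ((?x \<omega> - ?m) * f (X \<omega>)) \<le> norm (C * \<bar>?x \<omega> - ?m\<bar> ^ 1)"
        by (simp add: abs_mult mult.commute)
    qed
  qed measurable
  show int_g: "integrable P (\<lambda>\<omega>. g (X \<omega>))"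
    by (rule integrable_const_bound[where B=C]) (use g in auto)
  have ind: "indep_var borel ?xE borel ?R" by (rule gaussian_matrix_entry_indep_rest[OF P G])
  then have pair: "distr P borel ?xE \<Otimes>\<^sub>M distr P borel ?R = distr P (borel \<Otimes>\<^sub>M borel) (\<lambda>\<omega>. (?xE \<omega>, ?R \<omega>))"
    and R [measurable]: "?R \<in> borel_measurable P"
    unfolding indep_var_distribution_eq by auto
  interpret D1: prob_space "distr P borel ?xE" by (rule prob_space_distr) simp
  interpret D2: prob_space "distr P borel ?R" by (rule prob_space_distr) simp
  interpret D12: pair_prob_space "distr P borel ?xE" "distr P borel ?R" ..
  have hm [measurable]: "case_prod ?h \<in> borel_measurable (borel \<Otimes>\<^sub>M borel)" by measurable
  have h_eq: "?h (?xE \<omega>) (?R \<omega>) = (?x \<omega> - ?m) * f (X \<omega>) - g (X \<omega>)" for \<omega> by simp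
  have "integrable P (\<lambda>\<omega>. ?h (?xE \<omega>) (?R \<omega>))" unfolding h_eq using int_f int_g by simp
  then have int_h: "integrable (distr P borel ?xE \<Otimes>\<^sub>M distr P borel ?R) (case_prod ?h)"
    unfolding pair by (subst integrable_distr_eq) auto
  have inner: "(\<integral>x. ?h x r \<partial>distr P borel ?xE) = 0" for r
  proof -
    have [measurable]: "(\<lambda>Y. ?h Y r) \<in> borel_measurable borel" by measurable
    let ?k = "\<lambda>x. (x - ?m) * f (r + x *\<^sub>R ?E) - g (r + x *\<^sub>R ?E)"
    have "(\<integral>Y. ?h Y r \<partial>distr P borel ?xE) = (\<integral>\<omega>. ?h (?xE \<omega>) r \<partial>P)"
      by (rule integral_distr) auto
    also have "\<dots> = (\<integral>\<omega>. ?k (?x \<omega>) \<partial>P)" by simp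
    also have "\<dots> = (\<integral>x. normal_density ?m 1 x * ?k x \<partial>lborel)"
      by (rule gaussian_matrix_entry_integral[OF G]) measurable
    also have "\<dots> = 0"
    proof (rule integral_normal_stein[where C=C])
      fix x
      have "((\<lambda>s. f ((r + x *\<^sub>R ?E) + (s - x) *\<^sub>R ?E)) has_real_derivative g (r + x *\<^sub>R ?E)) (at x)"
        using DERIV_shift[of "\<lambda>s. f ((r + x *\<^sub>R ?E) + s *\<^sub>R ?E)" "g (r + x *\<^sub>R ?E)" x "-x"]
          D[of "r + x *\<^sub>R ?E"] by simp
      then show "((\<lambda>s. f (r + s *\<^sub>R ?E)) has_real_derivative g (r + x *\<^sub>R ?E)) (at x)"
        by (simp add: algebra_simps)
    next
      show "continuous_on UNIV (\<lambda>x. g (r + x *\<^sub>R ?E))"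
        by (rule continuous_on_compose2[OF cg]) (auto intro!: continuous_intros)
    qed (use f g in auto)
    finally show ?thesis .
  qed
  have "(\<integral>\<omega>. (?x \<omega> - ?m) * f (X \<omega>) - g (X \<omega>) \<partial>P) = (\<integral>\<omega>. case_prod ?h (?xE \<omega>, ?R \<omega>) \<partial>P)"
    using h_eq by simp
  also have "\<dots> = (\<integral>z. case_prod ?h z \<partial>(distr P borel ?xE \<Otimes>\<^sub>M distr P borel ?R))"
    unfolding pair by (rule integral_distr[symmetric]) auto
  also have "\<dots> = (\<integral>r. (\<integral>x. ?h x r \<partial>distr P borel ?xE) \<partial>distr P borel ?R)"
    by (rule D12.integral_snd[symmetric, OF int_h])
  also have "\<dots> = 0" unfolding inner by simp
  finally show "(\<integral>\<omega>. (?x \<omega> - ?m) * f (X \<omega>) \<partial>P) = (\<integral>\<omega>. g (X \<omega>) \<partial>P)"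
    using int_f int_g by simp
qed

section \<open>Second moments of a Gaussian matrix\<close>

lemma gaussian_matrix_entry_mean:
  assumes G: "gaussian_matrix P X M"
  shows "has_bochner_integral P (\<lambda>\<omega>. X \<omega> $ i $ j - M $ i $ j) 0"
proof -
  have m [measurable]: "(\<lambda>\<omega>. X \<omega> $ i $ j) \<in> borel_measurable P"
    using distributed_measurable[OF gaussian_matrixD(2)[OF G, of i j]] by simp
  have "integrable P (\<lambda>\<omega>. X \<omega> $ i $ j - M $ i $ j)"
    by (rule Bochner_Integration.integrable_bound[OF gaussian_matrix_entry_moment_integrable[OF G, of i j 1]]) auto
  moreover have "(\<integral>\<omega>. X \<omega> $ i $ j - M $ i $ j \<partial>P) = 0"
    using gaussian_matrix_entry_integral[OF G, of "\<lambda>x. x - M $ i $ j" i j]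
      integral_normal_moment_odd[of 1 "M $ i $ j" 0] by simp
  ultimately show ?thesis by (simp add: has_bochner_integral_iff)
qed

lemma gaussian_matrix_entry_covariance:
  fixes X :: "'a \<Rightarrow> real ^ 'p ^ 'n"
  assumes P: "prob_space P" and G: "gaussian_matrix P X M"
  shows "has_bochner_integral P (\<lambda>\<omega>. (X \<omega> $ i $ j - M $ i $ j) * (X \<omega> $ k $ l - M $ k $ l))
    (if (i, j) = (k, l) then 1 else 0)"
proof (cases "(i, j) = (k, l)")
  case True
  have "integrable P (\<lambda>\<omega>. (X \<omega> $ i $ j - M $ i $ j)\<^sup>2)"
    using gaussian_matrix_entry_moment_integrable[OF G, of i j 2] by simp
  moreover have "(\<integral>\<omega>. (X \<omega> $ i $ j - M $ i $ j)\<^sup>2 \<partial>P) = 1"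
    using gaussian_matrix_entry_integral[OF G, of "\<lambda>x. (x - M $ i $ j)\<^sup>2" i j]
      integral_normal_moment_even[of 1 "M $ i $ j" 1] by simp
  ultimately show ?thesis using True by (simp add: has_bochner_integral_iff power2_eq_square)
next
  case False
  interpret prob_space P by fact
  have "indep_var borel ((\<lambda>Y. Y $ i $ j - M $ i $ j) \<circ> (\<lambda>\<omega>. (X \<omega> $ i $ j) *\<^sub>R axis i (axis j 1)))
    borel ((\<lambda>Y. Y $ k $ l - M $ k $ l) \<circ> (\<lambda>\<omega>. X \<omega> - (X \<omega> $ i $ j) *\<^sub>R axis i (axis j 1)))"
    by (rule indep_var_compose[OF gaussian_matrix_entry_indep_rest[OF P G]])
       (auto intro!: borel_measurable_continuous_onI continuous_intros)
  also have "(\<lambda>Y. Y $ i $ j - M $ i $ j) \<circ> (\<lambda>\<omega>. (X \<omega> $ i $ j) *\<^sub>R axis i (axis j 1)) = (\<lambda>\<omega>. X \<omega> $ i $ j - M $ i $ j)" by auto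
  also have "(\<lambda>Y. Y $ k $ l - M $ k $ l) \<circ> (\<lambda>\<omega>. X \<omega> - (X \<omega> $ i $ j) *\<^sub>R axis i (axis j 1))
     = (\<lambda>\<omega>. X \<omega> $ k $ l - M $ k $ l)"
    using False by (auto simp: fun_eq_iff axis_def)
  finally have ind: "indep_var borel (\<lambda>\<omega>. X \<omega> $ i $ j - M $ i $ j) borel (\<lambda>\<omega>. X \<omega> $ k $ l - M $ k $ l)" .
  have int: "integrable P (\<lambda>\<omega>. X \<omega> $ i $ j - M $ i $ j)" "(\<integral>\<omega>. X \<omega> $ i $ j - M $ i $ j \<partial>P) = 0" for i j
    using gaussian_matrix_entry_mean[OF G, of i j] by (simp_all add: has_bochner_integral_iff)
  show ?thesis using False indep_var_integrable[OF ind int(1) int(1)]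
      indep_var_lebesgue_integral[OF ind int(1) int(1)] int(2)
    by (auto simp: has_bochner_integral_iff)
qed

lemma gaussian_matrix_sq_norm_mean:
  fixes X :: "'a \<Rightarrow> real ^ 'p ^ 'n"
  assumes P: "prob_space P" and G: "gaussian_matrix P X M"
  shows "has_bochner_integral P (\<lambda>\<omega>. (norm ((X \<omega> - M) *v u + b))\<^sup>2) (real CARD('n) * (norm u)\<^sup>2 + (norm b)\<^sup>2)"
proof -
  interpret prob_space P by fact
  let ?Z = "\<lambda>i j \<omega>. X \<omega> $ i $ j - M $ i $ j"
  have "has_bochner_integral P
     (\<lambda>\<omega>. \<Sum>i\<in>UNIV. (\<Sum>j\<in>UNIV. \<Sum>k\<in>UNIV. u $ j * u $ k * (?Z i j \<omega> * ?Z i k \<omega>))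
        + 2 * b $ i * (\<Sum>j\<in>UNIV. u $ j * ?Z i j \<omega>) + (b $ i)\<^sup>2)
     (\<Sum>i\<in>(UNIV::'n set). (\<Sum>j\<in>UNIV. \<Sum>k\<in>UNIV. u $ j * u $ k * (if (i, j) = (i, k) then 1 else 0))
        + 2 * b $ i * (\<Sum>j\<in>(UNIV::'p set). u $ j * 0) + (b $ i)\<^sup>2)"
    by (intro has_bochner_integral_sum has_bochner_integral_add has_bochner_integral_mult_right
          gaussian_matrix_entry_covariance[OF P G] gaussian_matrix_entry_mean[OF G])
       (auto simp: has_bochner_integral_iff prob_space)
  also have "(\<lambda>\<omega>. \<Sum>i\<in>UNIV. (\<Sum>j\<in>UNIV. \<Sum>k\<in>UNIV. u $ j * u $ k * (?Z i j \<omega> * ?Z i k \<omega>))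
        + 2 * b $ i * (\<Sum>j\<in>UNIV. u $ j * ?Z i j \<omega>) + (b $ i)\<^sup>2)
     = (\<lambda>\<omega>. (norm ((X \<omega> - M) *v u + b))\<^sup>2)"
  proof
    fix \<omega>
    have sq: "(\<Sum>j\<in>UNIV. \<Sum>k\<in>UNIV. u $ j * u $ k * (?Z i j \<omega> * ?Z i k \<omega>)) = (\<Sum>j\<in>UNIV. u $ j * ?Z i j \<omega>)\<^sup>2" for i
      unfolding power2_eq_square sum_product by (intro sum.cong) (simp_all add: mult_ac)
    have row: "((X \<omega> - M) *v u) $ i = (\<Sum>j\<in>UNIV. u $ j * ?Z i j \<omega>)" for i
      by (simp add: matrix_vector_mult_def mult.commute)
    show "(\<Sum>i\<in>UNIV. (\<Sum>j\<in>UNIV. \<Sum>k\<in>UNIV. u $ j * u $ k * (?Z i j \<omega> * ?Z i k \<omega>))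
        + 2 * b $ i * (\<Sum>j\<in>UNIV. u $ j * ?Z i j \<omega>) + (b $ i)\<^sup>2) = (norm ((X \<omega> - M) *v u + b))\<^sup>2"
      unfolding power2_norm_eq_inner inner_vec_def sq vector_add_component row
      by (intro sum.cong) (simp_all add: power2_eq_square algebra_simps)
  qed
  also have "(\<Sum>i\<in>(UNIV::'n set). (\<Sum>j\<in>UNIV. \<Sum>k\<in>UNIV. u $ j * u $ k * (if (i, j) = (i, k) then 1 else 0))
        + 2 * b $ i * (\<Sum>j\<in>(UNIV::'p set). u $ j * 0) + (b $ i)\<^sup>2) = real CARD('n) * (norm u)\<^sup>2 + (norm b)\<^sup>2"
    unfolding power2_norm_eq_inner inner_vec_def
    by (simp add: sum.distrib power2_eq_square if_distrib cong: if_cong)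
  finally show ?thesis .
qed

lemma noise_sq_norm:
  fixes X :: "'a \<Rightarrow> real ^ 'p ^ 'n"
  assumes P: "prob_space P" and G: "gaussian_matrix P X M"
  shows "integrable P (\<lambda>\<omega>. (norm ((X \<omega> - M) *v v))\<^sup>2)"
  "(\<integral>\<omega>. (norm ((X \<omega> - M) *v v))\<^sup>2 \<partial>P) = real CARD('n) * (norm v)\<^sup>2"
  using gaussian_matrix_sq_norm_mean[OF P G, of v 0] by (auto simp: has_bochner_integral_iff)

section \<open>The divergence of the regularised fit\<close>

lemma ridge_solve_linear: "linear (ridge_solve e Y)"
  unfolding ridge_solve_def by (rule matrix_vector_mul_linear)

lemma ridge_gram_shift:
  fixes Y :: "real ^ 'p ^ 'n"
  shows "ridge_gram e (Y + s *\<^sub>R axis i (axis j 1)) *v w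
    = ridge_gram e Y *v w + s *\<^sub>R ((Y $ i \<bullet> w) *\<^sub>R axis j 1 + (w $ j) *\<^sub>R Y $ i + (s * w $ j) *\<^sub>R axis j 1)"
proof -
  have shift: "(Y + s *\<^sub>R axis i (axis j 1)) *v u = Y *v u + (s * u $ j) *\<^sub>R axis i 1" for u
  proof -
    have row: "(Y + s *\<^sub>R axis i (axis j 1)) $ k = Y $ k + (if k = i then s *\<^sub>R axis j 1 else 0)" for k
      by (simp add: axis_def)
    show ?thesis
      by (simp add: vec_eq_iff matrix_vector_mul_component row inner_add_left inner_axis' axis_def[of i]
          del: vector_add_component)
         (simp add: matrix_vector_mul_component inner_add_left inner_axis')
  qed
  show ?thesis
  proof (subst vector_eq_rdot[symmetric], intro allI)
    fix u
    have r: "(Y *v w) \<bullet> axis i 1 = Y $ i \<bullet> w" for w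
      by (simp add: inner_axis matrix_vector_mul_component)
    have r': "axis i 1 \<bullet> (Y *v w) = Y $ i \<bullet> w" for w
      by (simp add: inner_axis' matrix_vector_mul_component)
    show "(ridge_gram e (Y + s *\<^sub>R axis i (axis j 1)) *v w) \<bullet> u = (ridge_gram e Y *v w
      + s *\<^sub>R ((Y $ i \<bullet> w) *\<^sub>R axis j 1 + (w $ j) *\<^sub>R Y $ i + (s * w $ j) *\<^sub>R axis j 1)) \<bullet> u"
      unfolding inner_commute[of _ u] inner_add_right inner_ridge_gram shift
      by (simp add: inner_add_left inner_add_right inner_axis inner_axis' r r' matrix_vector_mul_component inner_axis_axis inner_commute[of u "Y $ i"]
          algebra_simps)
  qed
qed

text \<open>Since \<open>T(s) w = v + s a(s)\<close>, where \<open>T(s)\<close> is the regularised Gram matrix of the shifted \<open>Y\<close>, the solution \<open>w\<close> at \<open>0\<close>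
becomes at \<open>s\<close> the vector \<open>w - s T(s)\<^sup>-\<^sup>1 a(s)\<close>.  Hence the difference quotient of the fitted value is an explicit expression in \<open>T(s)\<^sup>-\<^sup>1\<close>, and
the derivative exists by continuity of matrix inversion (Caratheodory's criterion).\<close>

lemma fitted_value_derivative:
  fixes Y :: "real ^ 'p ^ 'n" and v :: "real ^ 'p"
  assumes "e > 0"
  defines "w \<equiv> ridge_solve e Y v"
  shows "((\<lambda>s. (Y + s *\<^sub>R axis i (axis j 1)) $ i \<bullet> ridge_solve e (Y + s *\<^sub>R axis i (axis j 1)) v)
    has_real_derivative w $ j * (1 - Y $ i \<bullet> ridge_solve e Y (Y $ i))
      - (Y $ i \<bullet> w) * (Y $ i \<bullet> ridge_solve e Y (axis j 1))) (at 0)"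
proof -
  let ?Y = "\<lambda>s. Y + s *\<^sub>R axis i (axis j 1)"
  let ?R = "\<lambda>s. ridge_solve e (?Y s)"
  let ?a = "\<lambda>s. (Y $ i \<bullet> w) *\<^sub>R axis j 1 + (w $ j) *\<^sub>R Y $ i + (s * w $ j) *\<^sub>R axis j 1"
  let ?g = "\<lambda>s. ?R s v $ j - ((Y $ i \<bullet> w) * (Y $ i \<bullet> ?R s (axis j 1))
      + w $ j * (Y $ i \<bullet> ?R s (Y $ i)) + s * w $ j * (Y $ i \<bullet> ?R s (axis j 1)))"
  have inv: "invertible (ridge_gram e Y)" for Y :: "real ^ 'p ^ 'n"
    by (rule invertible_ridge_gram[OF assms(1)])
  have diff: "?R s v = w - s *\<^sub>R ?R s (?a s)" for s
  proof -
    have "ridge_gram e (?Y s) *v w = v + s *\<^sub>R ?a s"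
      unfolding ridge_gram_shift by (simp add: w_def ridge_solve_solves[OF inv])
    then have "w = ?R s (v + s *\<^sub>R ?a s)"
      unfolding ridge_solve_def using matrix_inv_solves(2)[OF inv, of "?Y s" w] by simp
    then have "w = ?R s v + s *\<^sub>R ?R s (?a s)"
      by (simp only: linear_add[OF ridge_solve_linear] linear_scale[OF ridge_solve_linear])
    then show ?thesis unfolding eq_diff_eq by (rule sym)
  qed
  have slope: "?Y s $ i \<bullet> ?R s v - ?Y 0 $ i \<bullet> ?R 0 v = ?g s * (s - 0)" for s
  proof -
    have "?Y s $ i \<bullet> ?R s v - ?Y 0 $ i \<bullet> ?R 0 v = Y $ i \<bullet> (?R s v - w) + s * ?R s v $ j"
      by (simp add: w_def inner_add_left inner_diff_right axis_def[of i] inner_axis')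
    also have "Y $ i \<bullet> (?R s v - w) = - s * (Y $ i \<bullet> ?R s (?a s))"
      by (subst diff) (simp add: inner_diff_right)
    finally show ?thesis
      by (simp add: linear_add[OF ridge_solve_linear] linear_scale[OF ridge_solve_linear]
          inner_add_right algebra_simps)
  qed
  have cont: "isCont ?g 0"
  proof -
    have "((\<lambda>s. ?Y s) \<longlongrightarrow> ?Y 0) (at 0)" by (intro tendsto_intros)
    then have "((\<lambda>s. ?R s u) \<longlongrightarrow> ?R 0 u) (at 0)" for u
      by (intro tendsto_ridge_solve inv tendsto_const)
    then show ?thesis unfolding isCont_def by (intro tendsto_intros)
  qed
  have val: "?g 0 = w $ j * (1 - Y $ i \<bullet> ridge_solve e Y (Y $ i))
      - (Y $ i \<bullet> w) * (Y $ i \<bullet> ridge_solve e Y (axis j 1))"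
    by (simp add: w_def algebra_simps)
  show ?thesis unfolding CARAT_DERIV by (intro exI[of _ ?g] conjI allI slope cont val)
qed

text \<open>The divergence in direction \<open>v\<close> of \<open>Y \<mapsto> Y w\<close>.  Row \<open>i\<close> contributes \<open>(1 - h\<^sub>i) \<langle>v, w\<rangle> - (Y w)\<^sub>i\<^sup>2\<close> with \<open>h\<^sub>i\<close>
the leverage.  The leverages sum to at most \<open>p\<close>, and \<open>\<bar>Y w\<bar>\<^sup>2 \<le> \<langle>v, w\<rangle>\<close>, which leaves \<open>n - p - 1\<close>.\<close>

lemma divergence_lower_bound:
  fixes Y :: "real ^ 'p ^ 'n" and v :: "real ^ 'p"
  assumes "e > 0"
  defines "w \<equiv> ridge_solve e Y v"
  shows "(real CARD('n) - real CARD('p) - 1) * (v \<bullet> w)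
    \<le> (\<Sum>i\<in>UNIV. \<Sum>j\<in>UNIV. v $ j * (w $ j * (1 - Y $ i \<bullet> ridge_solve e Y (Y $ i))
      - (Y $ i \<bullet> w) * (Y $ i \<bullet> ridge_solve e Y (axis j 1))))"
proof -
  let ?h = "\<lambda>i. Y $ i \<bullet> ridge_solve e Y (Y $ i)"
  have inv: "invertible (ridge_gram e Y)" by (rule invertible_ridge_gram[OF assms(1)])
  have fitted: "(\<Sum>j\<in>UNIV. v $ j * (Y $ i \<bullet> ridge_solve e Y (axis j 1))) = Y $ i \<bullet> w" for i
  proof -
    have "(\<Sum>j\<in>UNIV. v $ j * (Y $ i \<bullet> ridge_solve e Y (axis j 1))) = v \<bullet> ridge_solve e Y (Y $ i)"
      unfolding row_inner_ridge_solve_axis[OF inv] by (simp add: inner_vec_def)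
    also have "\<dots> = Y $ i \<bullet> w" unfolding w_def by (rule ridge_solve_symmetric[OF inv])
    finally show ?thesis .
  qed
  have row: "(\<Sum>j\<in>UNIV. v $ j * (w $ j * (1 - ?h i)
      - (Y $ i \<bullet> w) * (Y $ i \<bullet> ridge_solve e Y (axis j 1)))) = (1 - ?h i) * (v \<bullet> w) - (Y $ i \<bullet> w)\<^sup>2" for i
  proof -
    have "(\<Sum>j\<in>UNIV. v $ j * (w $ j * (1 - ?h i)
      - (Y $ i \<bullet> w) * (Y $ i \<bullet> ridge_solve e Y (axis j 1)))) = (1 - ?h i) * (\<Sum>j\<in>UNIV. v $ j * w $ j)
       - (Y $ i \<bullet> w) * (\<Sum>j\<in>UNIV. v $ j * (Y $ i \<bullet> ridge_solve e Y (axis j 1)))"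
      unfolding sum_distrib_left sum_subtractf[symmetric] by (intro sum.cong) (simp_all add: algebra_simps)
    then show ?thesis
      using fitted[of i] by (simp add: inner_vec_def[of v] power2_eq_square)
  qed
  have "(\<Sum>i\<in>UNIV. (Y $ i \<bullet> w)\<^sup>2) = (norm (Y *v w))\<^sup>2"
    unfolding power2_norm_eq_inner inner_vec_def[of "Y *v w"]
    by (simp add: matrix_vector_mul_component power2_eq_square)
  also have "\<dots> \<le> v \<bullet> w"
    unfolding w_def by (rule ridge_fit_le_quadform[OF inv]) (use assms in simp)
  finally have fit: "(\<Sum>i\<in>UNIV. (Y $ i \<bullet> w)\<^sup>2) \<le> v \<bullet> w" .
  have "(\<Sum>i\<in>UNIV. ?h i) * (v \<bullet> w) \<le> real CARD('p) * (v \<bullet> w)"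
    by (intro mult_right_mono sum_leverage_le assms(1)) (use ridge_quadform_nonneg[OF inv, of v] assms in simp)
  moreover have "(\<Sum>i\<in>UNIV. (1 - ?h i) * (v \<bullet> w) - (Y $ i \<bullet> w)\<^sup>2)
      = real CARD('n) * (v \<bullet> w) - (\<Sum>i\<in>UNIV. ?h i) * (v \<bullet> w) - (\<Sum>i\<in>UNIV. (Y $ i \<bullet> w)\<^sup>2)"
    by (simp add: sum_subtractf left_diff_distrib sum_distrib_right)
  ultimately show ?thesis
    using fit unfolding row by (simp add: left_diff_distrib)
qed

section \<open>Stein bounds for the regularised inverse\<close>

lemma integral_double_sum:
  fixes F :: "'i \<Rightarrow> 'j \<Rightarrow> 'a \<Rightarrow> real"
  assumes "\<And>i j. integrable P (F i j)"
  shows "(\<integral>\<omega>. (\<Sum>i\<in>I. \<Sum>j\<in>J. c j * F i j \<omega>) \<partial>P) = (\<Sum>i\<in>I. \<Sum>j\<in>J. c j * (\<integral>\<omega>. F i j \<omega> \<partial>P))"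
  using assms by simp

context
  fixes P :: "'a measure" and X :: "'a \<Rightarrow> real ^ 'p ^ 'n" and M :: "real ^ 'p ^ 'n"
  assumes P: "prob_space P" and G: "gaussian_matrix P X M"
begin

lemma ridge_stein:
  assumes "e > 0"
  shows "integrable P (\<lambda>\<omega>. v \<bullet> ridge_solve e (X \<omega>) v)"
    and "integrable P (\<lambda>\<omega>. ((X \<omega> - M) *v v) \<bullet> (X \<omega> *v ridge_solve e (X \<omega>) v))"
    and "(real CARD('n) - real CARD('p) - 1) * (\<integral>\<omega>. v \<bullet> ridge_solve e (X \<omega>) v \<partial>P)
      \<le> (\<integral>\<omega>. ((X \<omega> - M) *v v) \<bullet> (X \<omega> *v ridge_solve e (X \<omega>) v) \<partial>P)"
proof -
  interpret prob_space P by (fact P)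
  note [measurable] = gaussian_matrix_measurable[OF G]
  have inv: "invertible (ridge_gram e Y)" for Y :: "real ^ 'p ^ 'n"
    by (rule invertible_ridge_gram[OF assms])
  let ?f = "\<lambda>i Y :: real ^ 'p ^ 'n. Y $ i \<bullet> ridge_solve e Y v"
  let ?g = "\<lambda>i j Y :: real ^ 'p ^ 'n. ridge_solve e Y v $ j * (1 - Y $ i \<bullet> ridge_solve e Y (Y $ i))
      - (Y $ i \<bullet> ridge_solve e Y v) * (Y $ i \<bullet> ridge_solve e Y (axis j 1))"
  let ?C = "norm v / e + norm v / sqrt e + norm v / sqrt e * (1 / sqrt e)"
  have lev: "Y $ i \<bullet> ridge_solve e Y (Y $ i) = (\<Sum>j\<in>UNIV. Y $ i $ j * (Y $ i \<bullet> ridge_solve e Y (axis j 1)))"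
    for Y :: "real ^ 'p ^ 'n" and i
    unfolding row_inner_ridge_solve_axis[OF inv] by (simp add: inner_vec_def)
  have cf: "continuous_on UNIV (?f i)" for i
    by (intro continuous_intros continuous_on_ridge_solve assms)
  \<comment> \<open>The leverage is expanded so that continuity is only needed at fixed right-hand sides.\<close>
  have cg: "continuous_on UNIV (?g i j)" for i j
    unfolding lev by (intro continuous_intros continuous_on_ridge_solve assms)
  have f: "\<bar>?f i Y\<bar> \<le> ?C" for i Y
    using row_ridge_solve_le[OF assms, of Y i v] assms by (smt (verit) divide_nonneg_nonneg norm_ge_zero real_sqrt_ge_zero mult_nonneg_nonneg)
  have g: "\<bar>?g i j Y\<bar> \<le> ?C" for i j Y
  proof -
    have "\<bar>ridge_solve e Y v $ j\<bar> * \<bar>1 - Y $ i \<bullet> ridge_solve e Y (Y $ i)\<bar> \<le> norm v / e * 1"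
      using leverage_bounds[OF assms, of Y i] order_trans[OF component_le_norm_cart norm_ridge_solve_le[OF assms]]
        assms
      by (intro mult_mono) auto
    moreover have "\<bar>Y $ i \<bullet> ridge_solve e Y v\<bar> * \<bar>Y $ i \<bullet> ridge_solve e Y (axis j 1)\<bar>
        \<le> norm v / sqrt e * (1 / sqrt e)"
      using row_ridge_solve_le[OF assms, of Y i v] row_ridge_solve_le[OF assms, of Y i "axis j 1"] assms
      by (intro mult_mono) auto
    moreover have "0 \<le> norm v / sqrt e" using assms by simp
    ultimately show ?thesis unfolding abs_mult[symmetric]
      using abs_triangle_ineq4[of "ridge_solve e Y v $ j * (1 - Y $ i \<bullet> ridge_solve e Y (Y $ i))"
        "(Y $ i \<bullet> ridge_solve e Y v) * (Y $ i \<bullet> ridge_solve e Y (axis j 1))"] by linarith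
  qed
  note stein = gaussian_matrix_stein[OF P G fitted_value_derivative[OF assms] cf cg f g]
  have cross: "((X \<omega> - M) *v v) \<bullet> (X \<omega> *v ridge_solve e (X \<omega>) v)
     = (\<Sum>i\<in>UNIV. \<Sum>j\<in>UNIV. v $ j * ((X \<omega> $ i $ j - M $ i $ j) * ?f i (X \<omega>)))" for \<omega>
  proof -
    have "((X \<omega> - M) *v v) \<bullet> (X \<omega> *v ridge_solve e (X \<omega>) v)
       = (\<Sum>i\<in>UNIV. (\<Sum>j\<in>UNIV. (X \<omega> $ i $ j - M $ i $ j) * v $ j) * ?f i (X \<omega>))"
      unfolding inner_vec_def[of "(X \<omega> - M) *v v"] matrix_vector_mul_component[of "X \<omega>"]
      by (simp add: matrix_vector_mult_def)
    then show ?thesis by (simp add: sum_distrib_left mult_ac)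
  qed
  show "integrable P (\<lambda>\<omega>. ((X \<omega> - M) *v v) \<bullet> (X \<omega> *v ridge_solve e (X \<omega>) v))"
    unfolding cross by (intro Bochner_Integration.integrable_sum integrable_mult_right stein(1))
  show int_q: "integrable P (\<lambda>\<omega>. v \<bullet> ridge_solve e (X \<omega>) v)"
  proof (rule integrable_const_bound[where B="(norm v)\<^sup>2 / e"])
    show "AE \<omega> in P. norm (v \<bullet> ridge_solve e (X \<omega>) v) \<le> (norm v)\<^sup>2 / e"
      using ridge_quadform_nonneg[OF inv] ridge_quadform_le[OF assms] assms by (intro AE_I2) simp
  qed measurable
  have "(real CARD('n) - real CARD('p) - 1) * (\<integral>\<omega>. v \<bullet> ridge_solve e (X \<omega>) v \<partial>P)
     = (\<integral>\<omega>. (real CARD('n) - real CARD('p) - 1) * (v \<bullet> ridge_solve e (X \<omega>) v) \<partial>P)" by simp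
  also have "\<dots> \<le> (\<integral>\<omega>. (\<Sum>i\<in>UNIV. \<Sum>j\<in>UNIV. v $ j * ?g i j (X \<omega>)) \<partial>P)"
    using divergence_lower_bound[OF assms, where ?'n='n and ?'p='p]
    by (intro integral_mono integrable_mult_right int_q Bochner_Integration.integrable_sum stein(2))
  also have "\<dots> = (\<Sum>i\<in>UNIV. \<Sum>j\<in>UNIV. v $ j * (\<integral>\<omega>. ?g i j (X \<omega>) \<partial>P))"
    by (rule integral_double_sum) (rule stein(2))
  also have "\<dots> = (\<Sum>i\<in>UNIV. \<Sum>j\<in>UNIV. v $ j * (\<integral>\<omega>. (X \<omega> $ i $ j - M $ i $ j) * ?f i (X \<omega>) \<partial>P))"
    unfolding stein(3) ..
  also have "\<dots> = (\<integral>\<omega>. (\<Sum>i\<in>UNIV. \<Sum>j\<in>UNIV. v $ j * ((X \<omega> $ i $ j - M $ i $ j) * ?f i (X \<omega>))) \<partial>P)"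
    by (rule integral_double_sum[symmetric]) (rule stein(1))
  finally show "(real CARD('n) - real CARD('p) - 1) * (\<integral>\<omega>. v \<bullet> ridge_solve e (X \<omega>) v \<partial>P)
      \<le> (\<integral>\<omega>. ((X \<omega> - M) *v v) \<bullet> (X \<omega> *v ridge_solve e (X \<omega>) v) \<partial>P)"
    unfolding cross .
qed

end

text \<open>If \<open>Y z = 0\<close>, testing the variational bound with multiples of \<open>z\<close> and letting \<open>e\<close> tend to \<open>0\<close> bounds every
multiple of \<open>z\<^sub>j\<close> by one constant.\<close>

lemma invertible_gram_if_ridge_quadform_bounded:
  fixes Y :: "real ^ 'p ^ 'n"
  assumes e: "\<And>k. e k > 0" "e \<longlonglongrightarrow> 0"
    and bdd: "\<And>j. \<exists>B. \<forall>k. axis j 1 \<bullet> ridge_solve (e k) Y (axis j 1) \<le> B"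
  shows "invertible (ridge_gram 0 Y)"
proof (rule invertible_if_kernel_trivial)
  fix z assume z: "ridge_gram 0 Y *v z = 0"
  have Yz: "Y *v z = 0"
    using inner_ridge_gram[of z 0 Y z] z by simp
  show "z = 0"
  proof (subst vec_eq_iff, intro allI)
    fix j
    obtain B where B: "\<And>k. axis j 1 \<bullet> ridge_solve (e k) Y (axis j 1) \<le> B" using bdd by blast
    have bound: "2 * a * z $ j \<le> B" for a
    proof (rule LIMSEQ_le_const2)
      have "(\<lambda>k. 2 * a * z $ j - e k * (norm (a *\<^sub>R z))\<^sup>2) \<longlonglongrightarrow> 2 * a * z $ j - 0 * (norm (a *\<^sub>R z))\<^sup>2"
        by (intro tendsto_intros e)
      then show "(\<lambda>k. 2 * a * z $ j - e k * (norm (a *\<^sub>R z))\<^sup>2) \<longlonglongrightarrow> 2 * a * z $ j" by simp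
      have "2 * a * z $ j - e k * (norm (a *\<^sub>R z))\<^sup>2 \<le> B" for k
        using ridge_variational[OF invertible_ridge_gram[OF e(1)], of k "axis j 1" "a *\<^sub>R z" Y] B[of k] e(1)[of k]
        by (simp add: matrix_vector_mult_scaleR Yz inner_axis' power_mult_distrib)
      then show "\<exists>N. \<forall>k\<ge>N. 2 * a * z $ j - e k * (norm (a *\<^sub>R z))\<^sup>2 \<le> B" by blast
    qed
    show "z $ j = 0 $ j"
    proof (rule ccontr)
      assume "z $ j \<noteq> 0 $ j"
      then show False using bound[of "(B + 1) / (2 * z $ j)"] by simp
    qed
  qed
qed

lemma norm_diff_scaleR_sq:
  "(norm (x - a *\<^sub>R y))\<^sup>2 = (norm x)\<^sup>2 - 2 * a * (x \<bullet> y) + a\<^sup>2 * (norm y)\<^sup>2"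
  unfolding power2_norm_eq_inner
  by (simp add: inner_diff_left inner_diff_right inner_commute power2_eq_square algebra_simps)

text \<open>Cauchy--Schwarz followed by the inequality of arithmetic and geometric means.  The value \<open>t = c\<close> lets half of the
quadratic form be absorbed in the uniform bound, and \<open>t = 1\<close> gives the dominating function of the limit.\<close>

lemma scaled_inner_le:
  assumes "t \<ge> 0" "norm y \<le> sqrt q" "q \<ge> 0"
  shows "t * \<bar>x \<bullet> y\<bar> \<le> ((norm x)\<^sup>2 + t\<^sup>2 * q) / 2"
proof -
  have "\<bar>x \<bullet> y\<bar> \<le> norm x * sqrt q"
    using Cauchy_Schwarz_ineq2[of x y] mult_left_mono[OF assms(2), of "norm x"] by simp
  then have "t * \<bar>x \<bullet> y\<bar> \<le> norm x * (t * sqrt q)"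
    using mult_left_mono[OF _ assms(1)] by (metis mult.left_commute)
  also have "\<dots> \<le> ((norm x)\<^sup>2 + (t * sqrt q)\<^sup>2) / 2"
    using sum_squares_bound[of "norm x" "t * sqrt q"] by simp
  finally show ?thesis using assms(3) by (simp add: power_mult_distrib)
qed

lemma borel_measurable_matrix_vector_mult [measurable (raw)]:
  fixes f :: "'a \<Rightarrow> real ^ 'p ^ 'n"
  assumes "f \<in> borel_measurable N" "g \<in> borel_measurable N"
  shows "(\<lambda>\<omega>. f \<omega> *v g \<omega>) \<in> borel_measurable N"
proof -
  have "(\<lambda>(Y, u). Y *v u) \<in> borel_measurable (borel :: ((real ^ 'p ^ 'n) \<times> (real ^ 'p)) measure)"
    by (intro borel_measurable_continuous_onI)
       (auto simp: matrix_vector_mult_def split_beta intro!: continuous_intros)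
  from measurable_compose[OF borel_measurable_Pair[OF assms] this] show ?thesis by simp
qed

context
  fixes P :: "'a measure" and X :: "'a \<Rightarrow> real ^ 'p ^ 'n" and M :: "real ^ 'p ^ 'n" and c :: real
  assumes P: "prob_space P" and G: "gaussian_matrix P X M"
    and c_eq: "c = real CARD('n) - real CARD('p) - 1" and dim: "c > 0"
begin

text \<open>For \<open>q = \<langle>v, (S + e I)\<^sup>-\<^sup>1 v\<rangle>\<close>, Stein's identity bounds \<open>c E q\<close> by the mean of the
cross term, and the cross term is controlled by \<open>q\<close> itself:
\<open>c\<^sup>2 E q \<le> (n \<bar>v\<bar>\<^sup>2 + c\<^sup>2 E q) / 2\<close>.\<close>

lemma ridge_quadform_mean_le:
  assumes "e > 0"
  shows "c\<^sup>2 * (\<integral>\<omega>. v \<bullet> ridge_solve e (X \<omega>) v \<partial>P) \<le> real CARD('n) * (norm v)\<^sup>2"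
proof -
  note stein = ridge_stein[OF P G assms, of v, folded c_eq]
  have inv: "invertible (ridge_gram e Y)" for Y :: "real ^ 'p ^ 'n" by (rule invertible_ridge_gram[OF assms])
  let ?q = "\<lambda>\<omega>. v \<bullet> ridge_solve e (X \<omega>) v"
  let ?x = "\<lambda>\<omega>. ((X \<omega> - M) *v v) \<bullet> (X \<omega> *v ridge_solve e (X \<omega>) v)"
  have "c\<^sup>2 * (\<integral>\<omega>. ?q \<omega> \<partial>P) \<le> (\<integral>\<omega>. c * ?x \<omega> \<partial>P)"
    using mult_left_mono[OF stein(3), of c] dim by (simp add: power2_eq_square mult.assoc)
  also have "\<dots> \<le> (\<integral>\<omega>. ((norm ((X \<omega> - M) *v v))\<^sup>2 + c\<^sup>2 * ?q \<omega>) / 2 \<partial>P)"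
  proof (rule integral_mono)
    fix \<omega>
    have "norm (X \<omega> *v ridge_solve e (X \<omega>) v) \<le> sqrt (?q \<omega>)"
      by (intro real_le_rsqrt ridge_fit_le_quadform inv) (use assms in simp)
    then have "c * \<bar>?x \<omega>\<bar> \<le> ((norm ((X \<omega> - M) *v v))\<^sup>2 + c\<^sup>2 * ?q \<omega>) / 2"
      using ridge_quadform_nonneg[OF inv, of v "X \<omega>"] assms dim by (intro scaled_inner_le) auto
    moreover have "c * ?x \<omega> \<le> c * \<bar>?x \<omega>\<bar>" using dim by (intro mult_left_mono) auto
    ultimately show "c * ?x \<omega> \<le> ((norm ((X \<omega> - M) *v v))\<^sup>2 + c\<^sup>2 * ?q \<omega>) / 2" by linarith
  qed (intro integrable_mult_right Bochner_Integration.integrable_add integrable_divide stein(1,2) noise_sq_norm(1)[OF P G])+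
  also have "\<dots> = (real CARD('n) * (norm v)\<^sup>2 + c\<^sup>2 * (\<integral>\<omega>. ?q \<omega> \<partial>P)) / 2"
    using stein(1) noise_sq_norm[OF P G, of v] by simp
  finally show ?thesis by simp
qed

section \<open>Removing the regularisation\<close>

text \<open>The conclusion is boundedness and not convergence to \<open>\<langle>v, S\<^sup>-\<^sup>1 v\<rangle>\<close>, because the invertibility of \<open>S\<close> is itself
deduced from it, by taking all unit vectors for \<open>v\<close>.\<close>

lemma ridge_quadform_bounded_AE:
  assumes e: "\<And>k. e k > 0" "decseq e"
  shows "AE \<omega> in P. \<exists>B. \<forall>k. v \<bullet> ridge_solve (e k) (X \<omega>) v \<le> B"
proof -
  note [measurable] = gaussian_matrix_measurable[OF G]
  have inv: "invertible (ridge_gram (e k) Y)" for k and Y :: "real ^ 'p ^ 'n"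
    by (rule invertible_ridge_gram[OF e(1)])
  let ?q = "\<lambda>k \<omega>. v \<bullet> ridge_solve (e k) (X \<omega>) v"
  have "incseq (\<lambda>k \<omega>. ennreal (?q k \<omega>))"
    using e by (auto simp: incseq_def le_fun_def decseq_def less_imp_le
        intro!: ennreal_leI ridge_quadform_antimono inv)
  then have "(\<integral>\<^sup>+ \<omega>. (SUP k. ennreal (?q k \<omega>)) \<partial>P) = (SUP k. \<integral>\<^sup>+ \<omega>. ennreal (?q k \<omega>) \<partial>P)"
    by (rule nn_integral_monotone_convergence_SUP) measurable
  also have "\<dots> \<le> ennreal (real CARD('n) * (norm v)\<^sup>2 / c\<^sup>2)"
  proof (rule SUP_least)
    fix k
    have "(\<integral>\<^sup>+ \<omega>. ennreal (?q k \<omega>) \<partial>P) = ennreal (\<integral>\<omega>. ?q k \<omega> \<partial>P)"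
      using ridge_quadform_nonneg[OF inv] e(1)
      by (intro nn_integral_eq_integral ridge_stein[OF P G]) (auto simp: less_imp_le)
    also have "\<dots> \<le> ennreal (real CARD('n) * (norm v)\<^sup>2 / c\<^sup>2)"
      using ridge_quadform_mean_le[OF e(1), of v k] dim by (intro ennreal_leI) (simp add: field_simps)
    finally show "(\<integral>\<^sup>+ \<omega>. ennreal (?q k \<omega>) \<partial>P) \<le> ennreal (real CARD('n) * (norm v)\<^sup>2 / c\<^sup>2)" .
  qed
  also have "\<dots> < \<infinity>" by simp
  finally have "(\<integral>\<^sup>+ \<omega>. (SUP k. ennreal (?q k \<omega>)) \<partial>P) \<noteq> \<infinity>" by simp
  then have "AE \<omega> in P. (SUP k. ennreal (?q k \<omega>)) \<noteq> \<infinity>"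
    by (intro nn_integral_noteq_infinite) measurable
  then show ?thesis
  proof eventually_elim
    fix \<omega> assume fin: "(SUP k. ennreal (?q k \<omega>)) \<noteq> \<infinity>"
    define S where "S = (SUP k. ennreal (?q k \<omega>))"
    have "?q k \<omega> \<le> enn2real S" for k
    proof -
      have "ennreal (?q k \<omega>) \<le> S" unfolding S_def by (rule SUP_upper) simp
      also have "S = ennreal (enn2real S)"
        using fin by (simp add: S_def[symmetric] ennreal_enn2real_if)
      finally show ?thesis by (simp add: ennreal_le_iff)
    qed
    then show "\<exists>B. \<forall>k. ?q k \<omega> \<le> B" by blast
  qed
qed

lemma gram_invertible_AE: "AE \<omega> in P. invertible (ridge_gram 0 (X \<omega>))"
proof -
  let ?e = "\<lambda>k. inverse (real (Suc k))"
  have "AE \<omega> in P. \<forall>j\<in>UNIV. \<exists>B. \<forall>k. axis j 1 \<bullet> ridge_solve (?e k) (X \<omega>) (axis j 1) \<le> B"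
    by (intro AE_finite_allI ridge_quadform_bounded_AE) (auto simp: decseq_def field_simps)
  then show ?thesis
  proof eventually_elim
    fix \<omega> assume "\<forall>j\<in>UNIV. \<exists>B. \<forall>k. axis j 1 \<bullet> ridge_solve (?e k) (X \<omega>) (axis j 1) \<le> B"
    then show "invertible (ridge_gram 0 (X \<omega>))"
      by (intro invertible_gram_if_ridge_quadform_bounded[of ?e] LIMSEQ_inverse_real_of_nat) auto
  qed
qed

text \<open>The regularised quadratic forms increase to the unregularised one with bounded means, so the limit is integrable;
it then dominates all cross terms.\<close>

lemma inverse_gram_stein:
  shows "integrable P (\<lambda>\<omega>. v \<bullet> ridge_solve 0 (X \<omega>) v)"
    and "integrable P (\<lambda>\<omega>. ((X \<omega> - M) *v v) \<bullet> (X \<omega> *v ridge_solve 0 (X \<omega>) v))"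
    and "c * (\<integral>\<omega>. v \<bullet> ridge_solve 0 (X \<omega>) v \<partial>P)
      \<le> (\<integral>\<omega>. ((X \<omega> - M) *v v) \<bullet> (X \<omega> *v ridge_solve 0 (X \<omega>) v) \<partial>P)"
proof -
  note [measurable] = gaussian_matrix_measurable[OF G]
  let ?e = "\<lambda>k. inverse (real (Suc k))"
  let ?q = "\<lambda>e \<omega>. v \<bullet> ridge_solve e (X \<omega>) v"
  let ?x = "\<lambda>e \<omega>. ((X \<omega> - M) *v v) \<bullet> (X \<omega> *v ridge_solve e (X \<omega>) v)"
  have e: "?e k > 0" for k by simp
  have inv: "invertible (ridge_gram (?e k) Y)" for k and Y :: "real ^ 'p ^ 'n"
    by (rule invertible_ridge_gram[OF e])
  have xm [measurable]: "?x e \<in> borel_measurable P" for e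
    by measurable
  have lim: "AE \<omega> in P. (\<lambda>k. ridge_solve (?e k) (X \<omega>) v) \<longlonglongrightarrow> ridge_solve 0 (X \<omega>) v"
    using gram_invertible_AE
    by eventually_elim (intro tendsto_ridge_solve LIMSEQ_inverse_real_of_nat tendsto_const)
  have mono: "AE \<omega> in P. mono (\<lambda>k. ?q (?e k) \<omega>)"
    by (intro AE_I2 monoI ridge_quadform_antimono inv) (auto simp: field_simps)
  have "incseq (\<lambda>k. \<integral>\<omega>. ?q (?e k) \<omega> \<partial>P)"
    by (intro monoI integral_mono ridge_stein[OF P G] ridge_quadform_antimono inv e) (auto simp: field_simps)
  moreover have "\<forall>k. (\<integral>\<omega>. ?q (?e k) \<omega> \<partial>P) \<le> real CARD('n) * (norm v)\<^sup>2 / c\<^sup>2"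
    using ridge_quadform_mean_le[OF e, of v] dim by (simp add: field_simps del: of_nat_Suc)
  ultimately obtain L where L: "(\<lambda>k. \<integral>\<omega>. ?q (?e k) \<omega> \<partial>P) \<longlonglongrightarrow> L"
    by (rule incseq_convergent) blast
  have limq: "AE \<omega> in P. (\<lambda>k. ?q (?e k) \<omega>) \<longlonglongrightarrow> ?q 0 \<omega>"
    using lim by eventually_elim (intro tendsto_intros)
  note mc = ridge_stein(1)[OF P G e, of v] mono limq L
  show int_q: "integrable P (?q 0)"
    by (rule integrable_monotone_convergence[OF mc]) measurable
  have int_q_eq: "(\<integral>\<omega>. ?q 0 \<omega> \<partial>P) = L"
    by (rule integral_monotone_convergence[OF mc]) measurable
  let ?w = "\<lambda>\<omega>. ((norm ((X \<omega> - M) *v v))\<^sup>2 + 1\<^sup>2 * ?q 0 \<omega>) / 2"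
  have int_w: "integrable P ?w" using int_q noise_sq_norm(1)[OF P G, of v] by simp
  have bound: "AE \<omega> in P. norm (?x (?e k) \<omega>) \<le> ?w \<omega>" for k
    using gram_invertible_AE
  proof eventually_elim
    fix \<omega> assume inv0: "invertible (ridge_gram 0 (X \<omega>))"
    have "(norm (X \<omega> *v ridge_solve (?e k) (X \<omega>) v))\<^sup>2 \<le> ?q (?e k) \<omega>"
      by (rule ridge_fit_le_quadform[OF inv]) simp
    also have "\<dots> \<le> ?q 0 \<omega>" by (rule ridge_quadform_antimono[OF inv0]) auto
    finally have "1 * \<bar>?x (?e k) \<omega>\<bar> \<le> ?w \<omega>"
      by (intro scaled_inner_le real_le_rsqrt ridge_quadform_nonneg inv0) auto
    then show "norm (?x (?e k) \<omega>) \<le> ?w \<omega>" by simp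
  qed
  have limx: "AE \<omega> in P. (\<lambda>k. ?x (?e k) \<omega>) \<longlonglongrightarrow> ?x 0 \<omega>"
    using lim
    by eventually_elim
       (intro tendsto_intros bounded_linear.tendsto[OF matrix_vector_mul_bounded_linear])
  show "integrable P (?x 0)"
    by (rule integrable_dominated_convergence[OF xm xm int_w limx bound])
  have "(\<lambda>k. \<integral>\<omega>. ?x (?e k) \<omega> \<partial>P) \<longlonglongrightarrow> (\<integral>\<omega>. ?x 0 \<omega> \<partial>P)"
    by (rule integral_dominated_convergence[OF xm xm int_w limx bound])
  then show "c * (\<integral>\<omega>. ?q 0 \<omega> \<partial>P) \<le> (\<integral>\<omega>. ?x 0 \<omega> \<partial>P)"
    unfolding int_q_eq
    by (rule LIMSEQ_le[OF tendsto_mult_left[OF L]]) (use ridge_stein(3)[OF P G e, of v, folded c_eq] in blast)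
qed

section \<open>Mean losses along a fixed direction\<close>

lemma efron_morris_loss_mean:
  "integrable P (\<lambda>\<omega>. (norm ((efron_morris (X \<omega>) - M) *v v))\<^sup>2)"
  "(\<integral>\<omega>. (norm ((efron_morris (X \<omega>) - M) *v v))\<^sup>2 \<partial>P)
    \<le> real CARD('n) * (norm v)\<^sup>2 - c\<^sup>2 * (\<integral>\<omega>. v \<bullet> ridge_solve 0 (X \<omega>) v \<partial>P)"
proof -
  note [measurable] = gaussian_matrix_measurable[OF G]
  let ?q = "\<lambda>\<omega>. v \<bullet> ridge_solve 0 (X \<omega>) v"
  let ?x = "\<lambda>\<omega>. ((X \<omega> - M) *v v) \<bullet> (X \<omega> *v ridge_solve 0 (X \<omega>) v)"
  let ?loss = "\<lambda>\<omega>. (norm ((efron_morris (X \<omega>) - M) *v v))\<^sup>2"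
  have em: "(efron_morris (X \<omega>) - M) *v v = (X \<omega> - M) *v v - c *\<^sub>R (X \<omega> *v ridge_solve 0 (X \<omega>) v)" for \<omega>
    by (simp add: efron_morris_def c_eq[symmetric] ridge_solve_def ridge_gram_0 matrix_vector_mult_diff_rdistrib
        matrix_vector_mult_diff_distrib matrix_vector_mul_assoc[symmetric]
        scaleR_matrix_vector_assoc[symmetric] matrix_vector_mult_scaleR)
  have [measurable]: "?loss \<in> borel_measurable P"
    unfolding em by measurable
  have eq: "AE \<omega> in P. (norm ((X \<omega> - M) *v v))\<^sup>2 - 2 * c * ?x \<omega> + c\<^sup>2 * ?q \<omega> = ?loss \<omega>"
    using gram_invertible_AE
  proof eventually_elim
    fix \<omega> assume "invertible (ridge_gram 0 (X \<omega>))"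
    then have "?q \<omega> = (norm (X \<omega> *v ridge_solve 0 (X \<omega>) v))\<^sup>2" using ridge_energy[of 0 "X \<omega>" v] by simp
    then show "(norm ((X \<omega> - M) *v v))\<^sup>2 - 2 * c * ?x \<omega> + c\<^sup>2 * ?q \<omega> = ?loss \<omega>"
      unfolding em norm_diff_scaleR_sq by simp
  qed
  have int: "has_bochner_integral P (\<lambda>\<omega>. (norm ((X \<omega> - M) *v v))\<^sup>2 - 2 * c * ?x \<omega> + c\<^sup>2 * ?q \<omega>)
     (real CARD('n) * (norm v)\<^sup>2 - 2 * c * (\<integral>\<omega>. ?x \<omega> \<partial>P) + c\<^sup>2 * (\<integral>\<omega>. ?q \<omega> \<partial>P))"
    using inverse_gram_stein[of v] noise_sq_norm[OF P G, of v]
    by (intro has_bochner_integral_add has_bochner_integral_diff has_bochner_integral_mult_right)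
       (auto simp: has_bochner_integral_iff)
  have loss: "has_bochner_integral P ?loss
     (real CARD('n) * (norm v)\<^sup>2 - 2 * c * (\<integral>\<omega>. ?x \<omega> \<partial>P) + c\<^sup>2 * (\<integral>\<omega>. ?q \<omega> \<partial>P))"
    using has_bochner_integral_cong_AE[THEN iffD1, OF _ _ eq int] borel_measurable_has_bochner_integral[OF int]
    by simp
  then show "integrable P ?loss" by (rule integrable.intros)
  have "c\<^sup>2 * (\<integral>\<omega>. ?q \<omega> \<partial>P) \<le> c * (\<integral>\<omega>. ?x \<omega> \<partial>P)"
    using mult_left_mono[OF inverse_gram_stein(3), of c v] dim by (simp add: power2_eq_square mult.assoc)
  then show "(\<integral>\<omega>. ?loss \<omega> \<partial>P) \<le> real CARD('n) * (norm v)\<^sup>2 - c\<^sup>2 * (\<integral>\<omega>. ?q \<omega> \<partial>P)"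
    using has_bochner_integral_integral_eq[OF loss] by simp
qed

text \<open>The variational bound at the deterministic vector \<open>r\<close>: the mean of \<open>\<bar>X r\<bar>\<^sup>2\<close> is the form of \<open>M\<^sup>T M + n I\<close> at \<open>r\<close>,
which is \<open>\<langle>v, r\<rangle>\<close>.\<close>

lemma inverse_gram_mean_lower_bound:
  "v \<bullet> ridge_solve (real CARD('n)) M v \<le> (\<integral>\<omega>. v \<bullet> ridge_solve 0 (X \<omega>) v \<partial>P)"
proof -
  interpret prob_space P by (fact P)
  let ?r = "ridge_solve (real CARD('n)) M v"
  have gram: "has_bochner_integral P (\<lambda>\<omega>. (norm (X \<omega> *v ?r))\<^sup>2)
     (real CARD('n) * (norm ?r)\<^sup>2 + (norm (M *v ?r))\<^sup>2)"
    using gaussian_matrix_sq_norm_mean[OF P G, of ?r "M *v ?r"]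
    by (simp add: matrix_vector_mult_diff_rdistrib)
  have "(\<integral>\<omega>. 2 * (v \<bullet> ?r) - (norm (X \<omega> *v ?r))\<^sup>2 \<partial>P) \<le> (\<integral>\<omega>. v \<bullet> ridge_solve 0 (X \<omega>) v \<partial>P)"
  proof (rule integral_mono_AE)
    show "AE \<omega> in P. 2 * (v \<bullet> ?r) - (norm (X \<omega> *v ?r))\<^sup>2 \<le> v \<bullet> ridge_solve 0 (X \<omega>) v"
      using gram_invertible_AE
      by eventually_elim (use ridge_variational[of 0 _ v ?r] in auto)
  qed (use gram inverse_gram_stein(1) in \<open>auto simp: has_bochner_integral_iff\<close>)
  also have "(\<integral>\<omega>. 2 * (v \<bullet> ?r) - (norm (X \<omega> *v ?r))\<^sup>2 \<partial>P) = v \<bullet> ?r"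
    using gram ridge_energy[OF invertible_ridge_gram[of "real CARD('n)" M], of v]
    by (simp add: has_bochner_integral_iff prob_space)
  finally show ?thesis .
qed

end

text \<open>The coefficient matrix equals \<open>I - n (M\<^sup>T M + n I)\<^sup>-\<^sup>1\<close>, so the error in direction \<open>v\<close> is the noise in direction
\<open>v - n r\<close> plus the bias \<open>- n M r\<close>.\<close>

lemma optimal_linear_loss_mean:
  fixes X :: "'a \<Rightarrow> real ^ 'p ^ 'n"
  assumes P: "prob_space P" and G: "gaussian_matrix P X M"
  shows "has_bochner_integral P (\<lambda>\<omega>. (norm ((linear_estimator (optimal_coeff M) (X \<omega>) - M) *v v))\<^sup>2)
    (real CARD('n) * (norm v)\<^sup>2 - (real CARD('n))\<^sup>2 * (v \<bullet> ridge_solve (real CARD('n)) M v))"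
proof -
  let ?n = "real CARD('n)"
  let ?r = "ridge_solve ?n M v"
  let ?u = "v - ?n *\<^sub>R ?r"
  have inv: "invertible (ridge_gram ?n M)" by (rule invertible_ridge_gram) simp
  have "optimal_coeff M *v v = matrix_inv (ridge_gram ?n M) *v (ridge_gram ?n M *v v - ?n *\<^sub>R v)"
    by (simp add: optimal_coeff_def ridge_gram_def matrix_vector_mul_assoc[symmetric]
        matrix_vector_mult_add_rdistrib scaleR_matrix_vector_assoc[symmetric])
  then have u: "optimal_coeff M *v v = ?u"
    by (simp add: matrix_vector_mult_diff_distrib matrix_inv_solves(2)[OF inv] ridge_solve_def
        matrix_vector_mult_scaleR)
  have loss: "(linear_estimator (optimal_coeff M) Y - M) *v v = (Y - M) *v ?u + (- ?n *\<^sub>R (M *v ?r))" for Y :: "real ^ 'p ^ 'n"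
    by (simp add: linear_estimator_def matrix_vector_mult_diff_rdistrib matrix_vector_mul_assoc[symmetric] u
        matrix_vector_mult_diff_distrib matrix_vector_mult_scaleR scaleR_diff_right)
  have "?n * (norm ?u)\<^sup>2 + (norm (- ?n *\<^sub>R (M *v ?r)))\<^sup>2 
     = ?n * (norm v)\<^sup>2 - 2 * ?n\<^sup>2 * (v \<bullet> ?r) + ?n\<^sup>2 * ((norm (M *v ?r))\<^sup>2 + ?n * (norm ?r)\<^sup>2)"
    unfolding norm_diff_scaleR_sq by (simp add: power_mult_distrib) (simp add: power2_eq_square algebra_simps)
  also have "\<dots> = ?n * (norm v)\<^sup>2 - ?n\<^sup>2 * (v \<bullet> ?r)"
    unfolding ridge_energy[OF inv, symmetric] by simp
  finally show ?thesis
    using gaussian_matrix_sq_norm_mean[OF P G, of ?u "- ?n *\<^sub>R (M *v ?r)"] unfolding loss by simp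
qed

section \<open>From mean losses to the risk matrix\<close>

lemma integrable_componentwise:
  fixes f :: "'a \<Rightarrow> 'b :: euclidean_space"
  assumes "\<And>b. b \<in> Basis \<Longrightarrow> integrable P (\<lambda>\<omega>. f \<omega> \<bullet> b)"
  shows "integrable P f"
proof -
  have "integrable P (\<lambda>\<omega>. \<Sum>b\<in>Basis. (f \<omega> \<bullet> b) *\<^sub>R b)"
    using assms by (intro Bochner_Integration.integrable_sum integrable_scaleR_left) auto
  then show ?thesis by (simp add: euclidean_representation)
qed

text \<open>By polarisation every entry of the loss matrix is a combination of three squared norms.\<close>

lemma matrix_quadratic_loss_integrable:
  fixes X :: "'a \<Rightarrow> real ^ 'p ^ 'n"
  assumes "\<And>v. integrable P (\<lambda>\<omega>. (norm ((est (X \<omega>) - M) *v v))\<^sup>2)"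
  shows "integrable P (\<lambda>\<omega>. matrix_quadratic_loss est M (X \<omega>))"
proof (rule integrable_componentwise)
  fix b :: "real ^ 'p ^ 'p" assume "b \<in> Basis"
  then obtain i j where b: "b = axis i (axis j 1)" by (auto simp: Basis_vec_def)
  let ?D = "\<lambda>\<omega>. est (X \<omega>) - M"
  let ?N = "\<lambda>v \<omega>. (norm (?D \<omega> *v v))\<^sup>2"
  have entry: "matrix_quadratic_loss est M (X \<omega>) \<bullet> b = axis i 1 \<bullet> (transpose (?D \<omega>) *v (?D \<omega> *v axis j 1))" for \<omega>
    unfolding b matrix_quadratic_loss_def matrix_vector_mul_assoc
    by (simp add: inner_axis inner_axis' matrix_vector_mul_component)
  have polar: "matrix_quadratic_loss est M (X \<omega>) \<bullet> b
     = (?N (axis i 1 + axis j 1) \<omega> - ?N (axis i 1) \<omega> - ?N (axis j 1) \<omega>) / 2" for \<omega>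
    unfolding entry inner_transpose_mult
    by (simp only: matrix_vector_right_distrib power2_norm_eq_inner)
       (simp add: inner_add_left inner_add_right inner_commute)
  then show "integrable P (\<lambda>\<omega>. matrix_quadratic_loss est M (X \<omega>) \<bullet> b)"
    unfolding polar by (intro integrable_divide Bochner_Integration.integrable_diff assms)
qed

lemma matrix_quadratic_risk_quadform:
  assumes "integrable P (\<lambda>\<omega>. matrix_quadratic_loss est M (X \<omega>))"
  shows "v \<bullet> (matrix_quadratic_risk P X est M *v v) = (\<integral>\<omega>. (norm ((est (X \<omega>) - M) *v v))\<^sup>2 \<partial>P)"
proof -
  have "linear (\<lambda>A. v \<bullet> (A *v v))"
    by (intro linearI)
       (simp_all add: matrix_vector_mult_add_rdistrib inner_add_right scaleR_matrix_vector_assoc[symmetric])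
  then have "bounded_linear (\<lambda>A. v \<bullet> (A *v v))" by (simp add: linear_conv_bounded_linear)
  from integral_bounded_linear[OF this assms]
  have "v \<bullet> (matrix_quadratic_risk P X est M *v v) = (\<integral>\<omega>. v \<bullet> (matrix_quadratic_loss est M (X \<omega>) *v v) \<partial>P)"
    by (simp add: matrix_quadratic_risk_def)
  also have "\<dots> = (\<integral>\<omega>. (norm ((est (X \<omega>) - M) *v v))\<^sup>2 \<partial>P)"
    by (simp only: matrix_quadratic_loss_def matrix_vector_mul_assoc[symmetric] inner_transpose_mult
        power2_norm_eq_inner)
  finally show ?thesis .
qed

lemma matrix_quadratic_risk_symmetric:
  fixes M :: "real ^ 'p ^ 'n"
  assumes "integrable P (\<lambda>\<omega>. matrix_quadratic_loss est M (X \<omega>))"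
  shows "transpose (matrix_quadratic_risk P X est M) = matrix_quadratic_risk P X est M"
proof -
  have "linear (\<lambda>A :: real ^ 'p ^ 'p. transpose A)"
    by (intro linearI) (simp_all add: transpose_def vec_eq_iff)
  then have "bounded_linear (\<lambda>A :: real ^ 'p ^ 'p. transpose A)" by (simp add: linear_conv_bounded_linear)
  from integral_bounded_linear[OF this assms] show ?thesis
    by (simp add: matrix_quadratic_risk_def matrix_quadratic_loss_def matrix_transpose_mul)
qed

theorem theorem3p1:
  fixes P :: "'a measure"
    and X :: "'a \<Rightarrow> real ^ 'p ^ 'n"
    and M :: "real ^ 'p ^ 'n"
  assumes "prob_space P"
    and "gaussian_matrix P X M"
    and "int CARD('n) - int CARD('p) - 1 > 0"
  shows "integrable P (\<lambda>\<omega>. matrix_quadratic_loss efron_morris M (X \<omega>))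
    \<and> integrable P (\<lambda>\<omega>. matrix_quadratic_loss (linear_estimator (optimal_coeff M)) M (X \<omega>))
    \<and> matrix_quadratic_risk P X efron_morris M
        \<preceq> matrix_quadratic_risk P X (linear_estimator (optimal_coeff M)) M
          + (2 * (real CARD('p) + 1)) *\<^sub>R mat 1"
proof -
  let ?n = "real CARD('n)" and ?p = "real CARD('p)"
  let ?c = "?n - ?p - 1"
  let ?lin = "linear_estimator (optimal_coeff M)"
  let ?A = "matrix_quadratic_risk P X efron_morris M" and ?B = "matrix_quadratic_risk P X ?lin M"
  have c: "?c > 0" using assms(3) by linarith
  note em = efron_morris_loss_mean[OF assms(1,2) refl c]
  note lin = optimal_linear_loss_mean[OF assms(1,2)]
  have int_em: "integrable P (\<lambda>\<omega>. matrix_quadratic_loss efron_morris M (X \<omega>))"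
    by (intro matrix_quadratic_loss_integrable em)
  have int_lin: "integrable P (\<lambda>\<omega>. matrix_quadratic_loss ?lin M (X \<omega>))"
    by (intro matrix_quadratic_loss_integrable integrable.intros[OF lin])
  have "positive_semidefinite (?B + (2 * (?p + 1)) *\<^sub>R mat 1 - ?A)"
    unfolding positive_semidefinite_def
  proof (intro conjI allI)
    show "transpose (?B + (2 * (?p + 1)) *\<^sub>R mat 1 - ?A) = ?B + (2 * (?p + 1)) *\<^sub>R mat 1 - ?A"
    proof -
      have "?A $ i $ j = ?A $ j $ i" "?B $ i $ j = ?B $ j $ i" for i j
        using matrix_quadratic_risk_symmetric[OF int_em] matrix_quadratic_risk_symmetric[OF int_lin]
        by (simp_all add: transpose_def vec_eq_iff)
      then show ?thesis by (simp add: transpose_def vec_eq_iff mat_def)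
    qed
  next
    fix v :: "real ^ 'p"
    let ?q = "v \<bullet> ridge_solve ?n M v"
    have n: "?n > 0" by simp
    have A: "v \<bullet> (?A *v v) \<le> ?n * (norm v)\<^sup>2 - ?c\<^sup>2 * ?q"
      unfolding matrix_quadratic_risk_quadform[OF int_em]
      using em(2)[of v] mult_left_mono[OF inverse_gram_mean_lower_bound[OF assms(1,2) refl c, of v], of "?c\<^sup>2"]
      by simp
    have B: "v \<bullet> (?B *v v) = ?n * (norm v)\<^sup>2 - ?n\<^sup>2 * ?q"
      unfolding matrix_quadratic_risk_quadform[OF int_lin]
      by (rule has_bochner_integral_integral_eq[OF lin])
    have q0: "0 \<le> ?q" by (rule ridge_quadform_nonneg[OF invertible_ridge_gram[OF n]]) simp
    have "(?n\<^sup>2 - ?c\<^sup>2) * ?q \<le> (2 * ?n * (?p + 1)) * ?q"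
      using q0 by (intro mult_right_mono) (simp_all add: power2_eq_square algebra_simps)
    also have "\<dots> \<le> (2 * ?n * (?p + 1)) * ((norm v)\<^sup>2 / ?n)"
      by (intro mult_left_mono ridge_quadform_le[OF n]) auto
    also have "\<dots> = 2 * (?p + 1) * (norm v)\<^sup>2" by simp
    finally have "?n\<^sup>2 * ?q - ?c\<^sup>2 * ?q \<le> 2 * (?p + 1) * (norm v)\<^sup>2" by (simp add: left_diff_distrib)
    moreover have "v \<bullet> ((?B + (2 * (?p + 1)) *\<^sub>R mat 1 - ?A) *v v)
       = v \<bullet> (?B *v v) + 2 * (?p + 1) * (norm v)\<^sup>2 - v \<bullet> (?A *v v)"
      by (simp add: matrix_vector_mult_diff_rdistrib matrix_vector_mult_add_rdistrib inner_add_right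
          inner_diff_right scaleR_matrix_vector_assoc[symmetric] power2_norm_eq_inner)
    ultimately show "0 \<le> v \<bullet> ((?B + (2 * (?p + 1)) *\<^sub>R mat 1 - ?A) *v v)" using A B by linarith
  qed
  then show ?thesis using int_em int_lin by (simp add: loewner_le_def)
qed

end
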